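(* Let $K$ be an arbitrary field, $m\geq 4$, $\Gamma\in\mathbb{S}(m)$, and let $A\in\mathcal{A}(m,\Gamma)$. Suppose that $s=|\operatorname{ind}(\Gamma)|\geq 2$ and $\operatorname{dec}(\Gamma)_{\geq 2}=\emptyset$, and let $\operatorname{ind}(\Gamma)=\{\nu_1,\ldots,\nu_s\}$. Then the algebra $A$ is generated by the elements $\{f_{\nu_1},\ldots,f_{\nu_s},x^{m+i}\mid i=0,1,\ldots,m-1\}$ subject to the defining relations (as a commutative algebra) $$f^c=[f^c]\quad\text{where } c\in\operatorname{ind}\mathbb{N}^s(m-1,\Gamma),$$ $$x^{m+i}f_{\nu_j}=[x^{m+i}f_{\nu_j}]\quad\text{for } i=0,1,\ldots,m-1\text{ and } j=1,\ldots,s,$$ $$x^{m+i}x^{m+j}=[x^{2m+i+j}]\quad\text{for } i,j=0,1,\ldots,m-1.$$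
   Context: $\mathbb{S}(m)$ is the set consisting of the empty set and of all non-empty subsets $\Gamma\subseteq\{2,\ldots,m-2\}$ such that $\Gamma+\Gamma\subseteq\Gamma\cup[m,\infty)$. An element of $\Gamma$ is decomposable if it is a sum of two elements of $\Gamma$; $\operatorname{ind}(\Gamma)$ and $\operatorname{dec}(\Gamma)$ are the sets of indecomposable and decomposable elements. Write $\operatorname{ind}(\Gamma)=\{\nu_1<\cdots<\nu_s\}$, $\nu=(\nu_1,\ldots,\nu_s)$, and $a\nu:=\sum_ia_i\nu_i$ for $a\in\mathbb{N}^s$ ($0\in\mathbb N$). For $\gamma\in\operatorname{dec}(\Gamma)$, $\operatorname{Rel}(\gamma):=\{a\in\mathbb{N}^s\mid a\nu=\gamma\}$, and $\operatorname{dec}(\Gamma)_{\geq 2}:=\{\gamma\in\operatorname{dec}(\Gamma)\mid|\operatorname{Rel}(\gamma)|\geq 2\}$. $\mathbb{N}^s(m-1,\Gamma):=\{c\in\mathbb{N}^s\mid c\nu\geq m-1\}$, an ideal of the monoid $(\mathbb{N}^s,+)$, and $\operatorname{ind}\mathbb{N}^s(m-1,\Gamma):=\mathbb{N}^s(m-1,\Gamma)\setminus\big(\mathbb{N}^s(m-1,\Gamma)+(\mathbb{N}^s\setminus\{0\})\big)$ is its (finite) set of minimal generators. $\mathcal{A}(m)$ is the set of all $K$-subalgebras $A$ of $K[x]$ such that $x^mK[x]\subset A$ and $x^{m-1}\notin A$. For $A\in\mathcal{A}(m)$, $\Gamma_A$ is the set of integers $\gamma$ with $1\leq\gamma\leq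 m-1$ such that $A$ contains an element of the form $x^\gamma+\sum_{j>\gamma}\lambda_jx^j$; one has $\Gamma_A\in\mathbb{S}(m)$. $\mathcal{A}(m,\Gamma):=\{A\in\mathcal{A}(m)\mid\Gamma_A=\Gamma\}$. The algebra $\overline{A}:=A/x^mK[x]\subseteq F:=K[x]/x^mK[x]$ has a unique $K$-basis $\{1,f_\gamma\mid\gamma\in\Gamma\}$ (the canonical basis) with $f_\gamma=x^\gamma+\sum_{\delta\in C\Gamma(\gamma)}\lambda_{\gamma\delta}x^\delta$, $\lambda_{\gamma\delta}\in K$, where $C\Gamma(\gamma)=\{\delta\mid\delta\notin\Gamma,\gamma<\delta\leq m-1\}$. Identifying $F$ with the space of polynomials of degree $\leq m-1$, each $f_\gamma$ is regarded as a polynomial of degree $\leq m-1$ lying in $A$. For $a\in\mathbb{N}^s$, $f^a:=\prod_{i=1}^sf_{\nu_i}^{a_i}$. Bracket notation: every $p\in K[x]$ is a unique sum $p=\overline{p}+[p]$ with $\deg\overline{p}\leq m-1$ and $[p]\in x^mK[x]$. Since $x^mK[x]=\bigoplus_{i=0}^{m-1}K[x^m]x^{m+i}$, one has a unique expression $[p]=\sum_{i=0}^{m-1}p_i(x^m)x^{m+i}$ with $p_i(x^m)\in K[x^m]$. In a relation, $[p]$ stands for this expression as a polynomial in the generators $x^m,\ldots,x^{2m-1}$, where $p$ is computed in $K[x]$. All other products in the relations are monomials in the abstract generators. *)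

theory Defs
  imports "HOL-Computational_Algebra.Polynomial" "HOL-Library.Poly_Mapping"
begin

section \<open>The sets \<open>\<Gamma>\<close> and their relations\<close>

definition SS :: "nat \<Rightarrow> nat set set" where
  "SS m = {\<Gamma>. \<Gamma> \<subseteq> {2..m-2} \<and> (\<forall>\<alpha>\<in>\<Gamma>. \<forall>\<beta>\<in>\<Gamma>. \<alpha> + \<beta> \<in> \<Gamma> \<union> {m..})}"

definition dec :: "nat set \<Rightarrow> nat set" where
  "dec \<Gamma> = {\<gamma>\<in>\<Gamma>. \<exists>\<alpha>\<in>\<Gamma>. \<exists>\<beta>\<in>\<Gamma>. \<gamma> = \<alpha> + \<beta>}"

definition ind :: "nat set \<Rightarrow> nat set" where
  "ind \<Gamma> = \<Gamma> - dec \<Gamma>"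

text \<open>
  The indecomposable elements are enumerated increasingly with indices \<open>0, \<dots>, s - 1\<close>,
  so \<open>nu \<Gamma> i\<close> is the element usually written with index \<open>i + 1\<close>.
  It is meaningful for \<open>i < card (ind \<Gamma>)\<close> only.
\<close>

definition nu :: "nat set \<Rightarrow> nat \<Rightarrow> nat" where
  "nu \<Gamma> i = sorted_list_of_set (ind \<Gamma>) ! i"

text \<open>The monoid of exponent vectors of length \<open>s\<close>, as finitely supported functions.\<close>

definition expvecs :: "nat \<Rightarrow> (nat \<Rightarrow>\<^sub>0 nat) set" where
  "expvecs s = {a. Poly_Mapping.keys a \<subseteq> {..<s}}"

definition wt :: "nat set \<Rightarrow> (nat \<Rightarrow>\<^sub>0 nat) \<Rightarrow> nat" where
  "wt \<Gamma> a = (\<Sum>i<card (ind \<Gamma>). Poly_Mapping.lookup a i * nu \<Gamma> i)"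

definition Rel :: "nat set \<Rightarrow> nat \<Rightarrow> (nat \<Rightarrow>\<^sub>0 nat) set" where
  "Rel \<Gamma> \<gamma> = {a \<in> expvecs (card (ind \<Gamma>)). wt \<Gamma> a = \<gamma>}"

definition dec_ge2 :: "nat set \<Rightarrow> nat set" where
  "dec_ge2 \<Gamma> = {\<gamma> \<in> dec \<Gamma>. card (Rel \<Gamma> \<gamma>) \<ge> 2}"

definition Nideal :: "nat \<Rightarrow> nat set \<Rightarrow> (nat \<Rightarrow>\<^sub>0 nat) set" where
  "Nideal n \<Gamma> = {c \<in> expvecs (card (ind \<Gamma>)). wt \<Gamma> c \<ge> n}"

definition ind_Nideal :: "nat \<Rightarrow> nat set \<Rightarrow> (nat \<Rightarrow>\<^sub>0 nat) set" where
  "ind_Nideal n \<Gamma> =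
     Nideal n \<Gamma> - {c + d | c d. c \<in> Nideal n \<Gamma> \<and> d \<in> expvecs (card (ind \<Gamma>)) - {0}}"


section \<open>The algebras and their canonical bases\<close>

definition is_subalgebra :: "'k::field poly set \<Rightarrow> bool" where
  "is_subalgebra A \<longleftrightarrow>
     1 \<in> A \<and> (\<forall>p\<in>A. \<forall>q\<in>A. p + q \<in> A \<and> p * q \<in> A) \<and> (\<forall>a. \<forall>p\<in>A. smult a p \<in> A)"

definition AA :: "nat \<Rightarrow> 'k::field poly set set" where
  "AA m = {A. is_subalgebra A \<and> (\<forall>q. monom 1 m * q \<in> A) \<and> monom 1 (m - 1) \<notin> A}"

definition Gam :: "nat \<Rightarrow> 'k::field poly set \<Rightarrow> nat set" where
  "Gam m A = {\<gamma>\<in>{1..m-1}. \<exists>q. monom 1 \<gamma> + monom 1 (Suc \<gamma>) * q \<in> A}"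

definition AAG :: "nat \<Rightarrow> nat set \<Rightarrow> 'k::field poly set set" where
  "AAG m \<Gamma> = {A \<in> AA m. Gam m A = \<Gamma>}"

definition CGam :: "nat \<Rightarrow> nat set \<Rightarrow> nat \<Rightarrow> nat set" where
  "CGam m \<Gamma> \<gamma> = {\<delta>. \<delta> \<notin> \<Gamma> \<and> \<gamma> < \<delta> \<and> \<delta> \<le> m - 1}"

text \<open>
  The quotient of \<open>K[x]\<close> by \<open>x\<^sup>m K[x]\<close> is identified with the space of polynomials of degree
  less than \<open>m\<close>; the image of \<open>A\<close> in it is then \<open>poly_cutoff m ` A\<close>. The family \<open>f\<close> is
  extended by zero to indices outside \<open>\<Gamma>\<close> to make it unique as a total function.
\<close>

definition is_canonical_basis :: "nat \<Rightarrow> 'k::field poly set \<Rightarrow> (nat \<Rightarrow> 'k poly) \<Rightarrow> bool" where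
  "is_canonical_basis m A f \<longleftrightarrow>
     (\<forall>\<gamma>\<in>Gam m A. \<exists>l. f \<gamma> = monom 1 \<gamma> + (\<Sum>\<delta>\<in>CGam m (Gam m A) \<gamma>. monom (l \<delta>) \<delta>)) \<and>
     (\<forall>\<gamma>. \<gamma> \<notin> Gam m A \<longrightarrow> f \<gamma> = 0) \<and>
     \<not> module.dependent smult (insert 1 (f ` Gam m A)) \<and>
     module.span smult (insert 1 (f ` Gam m A)) = poly_cutoff m ` A"

definition canonical_basis :: "nat \<Rightarrow> 'k::field poly set \<Rightarrow> nat \<Rightarrow> 'k poly" where
  "canonical_basis m A = (THE f. is_canonical_basis m A f)"

definition fpow :: "nat \<Rightarrow> 'k::field poly set \<Rightarrow> (nat \<Rightarrow>\<^sub>0 nat) \<Rightarrow> 'k poly" where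
  "fpow m A a =
     (\<Prod>i<card (ind (Gam m A)). canonical_basis m A (nu (Gam m A) i) ^ Poly_Mapping.lookup a i)"


section \<open>Presentations of commutative algebras\<close>

type_synonym ('v, 'k) mpoly = "('v \<Rightarrow>\<^sub>0 nat) \<Rightarrow>\<^sub>0 'k"

definition MConst :: "'k::comm_ring_1 \<Rightarrow> ('v, 'k) mpoly" where
  "MConst a = Poly_Mapping.single 0 a"

definition MVar :: "'v \<Rightarrow> ('v, 'k::comm_ring_1) mpoly" where
  "MVar v = Poly_Mapping.single (Poly_Mapping.single v 1) 1"

definition mpolys_in :: "'v set \<Rightarrow> ('v, 'k::comm_ring_1) mpoly set" where
  "mpolys_in V = {P. \<forall>e\<in>Poly_Mapping.keys P. Poly_Mapping.keys e \<subseteq> V}"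

text \<open>The \<open>K\<close>-algebra homomorphism to \<open>K[x]\<close> that maps each variable \<open>v\<close> to \<open>g v\<close>.\<close>

definition mpoly_eval :: "('v \<Rightarrow> 'k::comm_ring_1 poly) \<Rightarrow> ('v, 'k) mpoly \<Rightarrow> 'k poly" where
  "mpoly_eval g P =
     (\<Sum>e\<in>Poly_Mapping.keys P. smult (Poly_Mapping.lookup P e)
        (\<Prod>v\<in>Poly_Mapping.keys e. g v ^ Poly_Mapping.lookup e v))"

text \<open>The ideal generated by \<open>R\<close> in the polynomial ring in the variables \<open>V\<close>.\<close>

definition mpoly_ideal :: "'v set \<Rightarrow> ('v, 'k::comm_ring_1) mpoly set \<Rightarrow> ('v, 'k) mpoly set" where
  "mpoly_ideal V R =
     {\<Sum>r\<in>T. h r * r | T h. finite T \<and> T \<subseteq> R \<and> (\<forall>r\<in>T. h r \<in> mpolys_in V)}"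

text \<open>
  The subset \<open>A\<close> of \<open>K[x]\<close> is the commutative algebra generated by the elements \<open>g v\<close>, for
  \<open>v \<in> V\<close>, subject to the defining relations \<open>r = 0\<close>, for \<open>r \<in> R\<close>.
\<close>

definition presented_by ::
  "'k::comm_ring_1 poly set \<Rightarrow> 'v set \<Rightarrow> ('v \<Rightarrow> 'k poly) \<Rightarrow> ('v, 'k) mpoly set \<Rightarrow> bool" where
  "presented_by A V g R \<longleftrightarrow>
     R \<subseteq> mpolys_in V \<and>
     mpoly_eval g ` mpolys_in V = A \<and>
     {P \<in> mpolys_in V. mpoly_eval g P = 0} = mpoly_ideal V R"


section \<open>Generators, brackets and relations\<close>

text \<open>
  \<open>GenF j\<close> stands for the canonical basis element with index \<open>nu \<Gamma> j\<close>, and \<open>GenX i\<close>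
  for \<open>x\<close> to the power \<open>m + i\<close>.
\<close>

datatype gen = GenF nat | GenX nat

definition gens :: "nat \<Rightarrow> nat set \<Rightarrow> gen set" where
  "gens m \<Gamma> = GenF ` {..<card (ind \<Gamma>)} \<union> GenX ` {..<m}"

fun gen_val :: "nat \<Rightarrow> 'k::field poly set \<Rightarrow> gen \<Rightarrow> 'k poly" where
  "gen_val m A (GenF j) = canonical_basis m A (nu (Gam m A) j)"
| "gen_val m A (GenX i) = monom 1 (m + i)"

definition bracket :: "nat \<Rightarrow> 'k::comm_ring_1 poly \<Rightarrow> 'k poly" where
  "bracket m p = p - poly_cutoff m p"

text \<open>
  The polynomials \<open>p\<^sub>i\<close> with \<open>[p] = (\<Sum>i<m. p\<^sub>i(x\<^sup>m) x\<^sup>m\<^sup>+\<^sup>i)\<close>; that they are the unique ones is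
  lemmas \<open>bracket_decomp\<close> and \<open>bracket_decomp_unique\<close>.
\<close>

definition bracket_coeff :: "nat \<Rightarrow> 'k::comm_ring_1 poly \<Rightarrow> nat \<Rightarrow> 'k poly" where
  "bracket_coeff m p i = (\<Sum>k\<le>degree p. monom (coeff p (m * k + (m + i))) k)"

lemma coeff_bracket: "coeff (bracket m p) n = (if n < m then 0 else coeff p n)"
  by (simp add: bracket_def coeff_poly_cutoff)

lemma coeff_bracket_coeff:
  assumes "m > 0"
  shows "coeff (bracket_coeff m p i) k = coeff p (m * k + (m + i))"
proof (cases "k \<le> degree p")
  case True
  then show ?thesis
    by (simp add: bracket_coeff_def coeff_sum sum.delta)
next
  case False
  moreover have "k \<le> m * k" using assms by simp
  ultimately have "degree p < m * k + (m + i)" by linarith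
  with False show ?thesis
    by (simp add: bracket_coeff_def coeff_sum sum.delta coeff_eq_0)
qed

lemma coeff_pcompose_monom_mult:
  fixes q :: "'k::comm_ring_1 poly"
  assumes "m > 0" "i < m"
  shows "coeff (pcompose q (monom 1 m) * monom 1 (m + i)) n =
           (if n \<ge> m \<and> n mod m = i then coeff q (n div m - 1) else 0)"
proof -
  have "pcompose q (monom 1 m) * monom 1 (m + i) =
          (\<Sum>k\<le>degree q. monom (coeff q k) (m * k + (m + i)))"
    by (simp add: pcompose_altdef poly_altdef degree_map_poly coeff_map_poly monom_power
        sum_distrib_right mult_monom smult_monom)
  then have "coeff (pcompose q (monom 1 m) * monom 1 (m + i)) n =
          (\<Sum>k\<le>degree q. if m * k + (m + i) = n then coeff q k else 0)"
    by (simp add: coeff_sum)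
  also have "\<dots> = (\<Sum>k\<le>degree q. if n \<ge> m \<and> n mod m = i \<and> k = n div m - 1 then coeff q k else 0)"
  proof (rule sum.cong[OF refl])
    fix k
    have "m * k + (m + i) = n \<longleftrightarrow> n \<ge> m \<and> n mod m = i \<and> k = n div m - 1"
    proof
      assume n: "m * k + (m + i) = n"
      then have "n = i + m * Suc k" by simp
      then have "n mod m = i" "n div m = Suc k"
        using assms by (simp_all only: mod_mult_self2 div_mult_self2 mod_less div_less)
      with n show "n \<ge> m \<and> n mod m = i \<and> k = n div m - 1" by auto
    next
      assume *: "n \<ge> m \<and> n mod m = i \<and> k = n div m - 1"
      then have "n div m = Suc k"
        using assms by (simp add: div_greater_zero_iff)
      moreover have "n = m * (n div m) + n mod m" by simp
      ultimately have "n = m * Suc k + i" using * by metis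
      then show "m * k + (m + i) = n" by simp
    qed
    then show "(if m * k + (m + i) = n then coeff q k else 0) =
      (if n \<ge> m \<and> n mod m = i \<and> k = n div m - 1 then coeff q k else 0)" by simp
  qed
  also have "\<dots> = (if n \<ge> m \<and> n mod m = i then coeff q (n div m - 1) else 0)"
    by (auto simp: sum.delta coeff_eq_0)
  finally show ?thesis .
qed

lemma coeff_bracket_sum:
  fixes q :: "nat \<Rightarrow> 'k::comm_ring_1 poly"
  assumes "m > 0"
  shows "coeff (\<Sum>i<m. pcompose (q i) (monom 1 m) * monom 1 (m + i)) n =
           (if n \<ge> m then coeff (q (n mod m)) (n div m - 1) else 0)"
proof -
  have "coeff (\<Sum>i<m. pcompose (q i) (monom 1 m) * monom 1 (m + i)) n =
      (\<Sum>i<m. if n \<ge> m \<and> n mod m = i then coeff (q i) (n div m - 1) else 0)"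
    unfolding coeff_sum
    by (rule sum.cong[OF refl]) (use assms in \<open>simp add: coeff_pcompose_monom_mult\<close>)
  also have "\<dots> = (if n \<ge> m then coeff (q (n mod m)) (n div m - 1) else 0)"
    using assms by (auto simp: sum.delta)
  finally show ?thesis .
qed

lemma bracket_decomp:
  assumes "m > 0"
  shows "bracket m p =
           (\<Sum>i<m. pcompose (bracket_coeff m p i) (monom 1 m) * monom 1 (m + i))"
proof (rule poly_eqI)
  fix n
  show "coeff (bracket m p) n =
    coeff (\<Sum>i<m. pcompose (bracket_coeff m p i) (monom 1 m) * monom 1 (m + i)) n"
  proof (cases "n \<ge> m")
    case True
    then obtain k where k: "n div m = Suc k"
      using assms by (metis div_greater_zero_iff gr0_implies_Suc)
    have "n = m * (n div m) + n mod m" by simp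
    then have "n = m * Suc k + n mod m" using k by metis
    then have "m * k + (m + n mod m) = n" by simp
    then show ?thesis
      using assms True k by (simp add: coeff_bracket coeff_bracket_sum coeff_bracket_coeff)
  next
    case False
    then show ?thesis
      using assms by (simp add: coeff_bracket coeff_bracket_sum)
  qed
qed

lemma bracket_decomp_unique:
  assumes "bracket m p = (\<Sum>i<m. pcompose (q i) (monom 1 m) * monom 1 (m + i))" "i < m"
  shows "q i = bracket_coeff m p i"
proof (rule poly_eqI)
  fix k
  have m: "m > 0" using assms(2) by simp
  let ?n = "i + m * Suc k"
  have n: "?n mod m = i" "?n div m = Suc k"
    using assms m by (simp_all only: mod_mult_self2 div_mult_self2 mod_less div_less)
  have ge: "?n \<ge> m" by simp
  have "coeff (bracket m p) ?n = coeff (q i) k"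
    unfolding assms(1) coeff_bracket_sum[OF m] n using ge by simp
  moreover have "coeff (bracket m p) ?n = coeff p ?n"
    using ge by (simp only: coeff_bracket) auto
  moreover have "?n = m * k + (m + i)" by simp
  ultimately show "coeff (q i) k = coeff (bracket_coeff m p i) k"
    using m by (metis coeff_bracket_coeff)
qed

definition bracket_expr :: "nat \<Rightarrow> 'k::comm_ring_1 poly \<Rightarrow> (gen, 'k) mpoly" where
  "bracket_expr m p =
     (\<Sum>i<m. poly (map_poly MConst (bracket_coeff m p i)) (MVar (GenX 0)) * MVar (GenX i))"

definition F_monom :: "nat set \<Rightarrow> (nat \<Rightarrow>\<^sub>0 nat) \<Rightarrow> (gen, 'k::comm_ring_1) mpoly" where
  "F_monom \<Gamma> c = (\<Prod>i<card (ind \<Gamma>). MVar (GenF i) ^ Poly_Mapping.lookup c i)"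

definition relations :: "nat \<Rightarrow> 'k::field poly set \<Rightarrow> (gen, 'k) mpoly set" where
  "relations m A =
     {F_monom (Gam m A) c - bracket_expr m (fpow m A c) | c. c \<in> ind_Nideal (m - 1) (Gam m A)} \<union>
     {MVar (GenX i) * MVar (GenF j)
        - bracket_expr m (monom 1 (m + i) * canonical_basis m A (nu (Gam m A) j))
        | i j. i < m \<and> j < card (ind (Gam m A))} \<union>
     {MVar (GenX i) * MVar (GenX j) - bracket_expr m (monom 1 (2 * m + i + j))
        | i j. i < m \<and> j < m}"

end

theory Submission
  imports Defs
begin

text \<open>
  Modulo the relations, every product involving some \<open>x\<^sup>m\<^sup>+\<^sup>i\<close> reduces to a bracket expression, and so
  does every monomial in the \<open>f\<^bsub>\<nu>\<^esub>\<close> of weight at least \<open>m - 1\<close>. The monomials that remain have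
  weights in \<open>\<Gamma> \<union> {0}\<close>, and since \<open>dec(\<Gamma>)\<^sub>\<ge>\<^sub>2\<close> is empty each such weight \<open>\<gamma>\<close> belongs to exactly
  one of them. Hence every element of the polynomial ring is congruent to a combination of these
  monomials plus \<open>[q]\<close> for some \<open>q\<close>. In \<open>K[x]\<close> the monomial of weight \<open>\<gamma>\<close> starts with \<open>x\<^sup>\<gamma>\<close>, so
  such a normal form vanishes there only if it is zero, and comparing lowest terms shows that
  the normal forms exhaust \<open>A\<close>.
\<close>

section \<open>Multivariate polynomials\<close>

lemma sum_single_lookup:
  "(\<Sum>e\<in>Poly_Mapping.keys p. Poly_Mapping.single e (Poly_Mapping.lookup p e)) = p"
  by (rule poly_mapping_eqI) (auto simp: lookup_sum lookup_single when_def in_keys_iff)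

lemma keys_add_nat:
  fixes a b :: "'v \<Rightarrow>\<^sub>0 nat"
  shows "Poly_Mapping.keys (a + b) = Poly_Mapping.keys a \<union> Poly_Mapping.keys b"
  by (auto simp: in_keys_iff lookup_add)

lemma MConst_add: "MConst (a + b) = MConst a + MConst b"
  by (simp add: MConst_def single_add)

lemma MConst_mult: "MConst (a * b) = MConst a * MConst b"
  by (simp add: MConst_def mult_single)

lemma MConst_0 [simp]: "MConst 0 = 0"
  by (simp add: MConst_def)

lemma MConst_1 [simp]: "MConst 1 = 1"
  by (simp add: MConst_def)

lemma MConst_eq_0_iff [simp]: "MConst a = 0 \<longleftrightarrow> a = 0"
  by (metis MConst_def lookup_single_eq lookup_zero single_zero)

lemma zero_in_mpolys_in [simp]: "0 \<in> mpolys_in V"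
  by (simp add: mpolys_in_def)

lemma MConst_in_mpolys_in [simp]: "MConst c \<in> mpolys_in V"
  by (simp add: mpolys_in_def MConst_def)

lemma one_in_mpolys_in [simp]: "1 \<in> mpolys_in V"
  by (metis MConst_1 MConst_in_mpolys_in)

lemma MVar_in_mpolys_in [simp]: "v \<in> V \<Longrightarrow> MVar v \<in> mpolys_in V"
  by (simp add: mpolys_in_def MVar_def)

lemma add_in_mpolys_in: "p \<in> mpolys_in V \<Longrightarrow> q \<in> mpolys_in V \<Longrightarrow> p + q \<in> mpolys_in V"
  using keys_add[of p q] by (auto simp: mpolys_in_def)

lemma uminus_in_mpolys_in: "p \<in> mpolys_in V \<Longrightarrow> - p \<in> mpolys_in V"
  by (auto simp: mpolys_in_def in_keys_iff)

lemma diff_in_mpolys_in: "p \<in> mpolys_in V \<Longrightarrow> q \<in> mpolys_in V \<Longrightarrow> p - q \<in> mpolys_in V"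
  by (metis add_in_mpolys_in diff_conv_add_uminus uminus_in_mpolys_in)

lemma mult_in_mpolys_in:
  assumes "p \<in> mpolys_in V" "q \<in> mpolys_in V"
  shows "p * q \<in> mpolys_in V"
  unfolding mpolys_in_def
proof (intro CollectI ballI)
  fix e assume "e \<in> Poly_Mapping.keys (p * q)"
  then obtain a b where "e = a + b" "a \<in> Poly_Mapping.keys p" "b \<in> Poly_Mapping.keys q"
    using keys_mult[of p q] by blast
  then show "Poly_Mapping.keys e \<subseteq> V"
    using assms keys_add[of a b] unfolding mpolys_in_def by blast
qed

lemma sum_in_mpolys_in: "(\<And>i. i \<in> I \<Longrightarrow> p i \<in> mpolys_in V) \<Longrightarrow> sum p I \<in> mpolys_in V"
  by (induction I rule: infinite_finite_induct) (auto intro: add_in_mpolys_in)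

lemma prod_in_mpolys_in: "(\<And>i. i \<in> I \<Longrightarrow> p i \<in> mpolys_in V) \<Longrightarrow> prod p I \<in> mpolys_in V"
  by (induction I rule: infinite_finite_induct) (auto intro: mult_in_mpolys_in)

lemma power_in_mpolys_in: "p \<in> mpolys_in V \<Longrightarrow> p ^ n \<in> mpolys_in V"
  by (induction n) (auto intro: mult_in_mpolys_in)

lemma mpolys_in_induct [consumes 1, case_names const add mult_var]:
  assumes "p \<in> mpolys_in V"
    and const: "\<And>c. Q (MConst c)"
    and add: "\<And>p q. p \<in> mpolys_in V \<Longrightarrow> q \<in> mpolys_in V \<Longrightarrow> Q p \<Longrightarrow> Q q \<Longrightarrow> Q (p + q)"
    and mult_var: "\<And>v p. v \<in> V \<Longrightarrow> p \<in> mpolys_in V \<Longrightarrow> Q p \<Longrightarrow> Q (MVar v * p)"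
  shows "Q p"
proof -
  have monomial: "Q (Poly_Mapping.single e c)" if "Poly_Mapping.keys e \<subseteq> V" for e c
    using that
  proof (induction "\<Sum>v\<in>Poly_Mapping.keys e. Poly_Mapping.lookup e v" arbitrary: e rule: less_induct)
    case less
    show ?case
    proof (cases "e = 0")
      case True
      then show ?thesis using const[of c] by (simp add: MConst_def)
    next
      case False
      then obtain v where v: "v \<in> Poly_Mapping.keys e"
        by (metis equals0I keys_eq_empty)
      define e' where "e' = e - Poly_Mapping.single v 1"
      have e: "e = Poly_Mapping.single v 1 + e'"
        using v by (intro poly_mapping_eqI)
          (auto simp: e'_def lookup_add lookup_minus lookup_single when_def in_keys_iff)
      have sub: "Poly_Mapping.keys e' \<subseteq> Poly_Mapping.keys e"
        unfolding e by (auto simp: keys_add_nat)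
      have "(\<Sum>w\<in>Poly_Mapping.keys e'. Poly_Mapping.lookup e' w)
          = (\<Sum>w\<in>Poly_Mapping.keys e. Poly_Mapping.lookup e' w)"
        by (rule sum.mono_neutral_left) (use sub in \<open>auto simp: in_keys_iff\<close>)
      also have "\<dots> < (\<Sum>w\<in>Poly_Mapping.keys e. Poly_Mapping.lookup e w)"
        by (rule sum_strict_mono_ex1)
          (use v in \<open>auto simp: e'_def lookup_minus lookup_single when_def in_keys_iff\<close>)
      finally have "Q (Poly_Mapping.single e' c)"
        using less sub by blast
      moreover have "Poly_Mapping.single e' c \<in> mpolys_in V"
        using less.prems sub by (auto simp: mpolys_in_def)
      ultimately have "Q (MVar v * Poly_Mapping.single e' c)"
        using mult_var v less.prems by blast
      then show ?thesis
        by (simp add: e MVar_def mult_single)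
    qed
  qed
  have "(\<Sum>e\<in>E. Poly_Mapping.single e (Poly_Mapping.lookup p e)) \<in> mpolys_in V
      \<and> Q (\<Sum>e\<in>E. Poly_Mapping.single e (Poly_Mapping.lookup p e))"
    if "finite E" "E \<subseteq> Poly_Mapping.keys p" for E
    using that
  proof (induction E rule: finite_induct)
    case empty
    then show ?case using const[of 0] by simp
  next
    case (insert e E)
    have e: "Poly_Mapping.keys e \<subseteq> V"
      using insert.prems assms(1) by (auto simp: mpolys_in_def)
    then have "Poly_Mapping.single e (Poly_Mapping.lookup p e) \<in> mpolys_in V"
      by (auto simp: mpolys_in_def)
    with e insert show ?case
      by (auto intro: add add_in_mpolys_in monomial)
  qed
  from this[of "Poly_Mapping.keys p"] show ?thesis
    by (simp add: sum_single_lookup)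
qed

lemma prod_power_add:
  fixes g :: "'v \<Rightarrow> 'a::comm_semiring_1"
  shows "(\<Prod>v\<in>Poly_Mapping.keys (d + e). g v ^ Poly_Mapping.lookup (d + e) v) =
    (\<Prod>v\<in>Poly_Mapping.keys d. g v ^ Poly_Mapping.lookup d v) *
    (\<Prod>v\<in>Poly_Mapping.keys e. g v ^ Poly_Mapping.lookup e v)"
proof -
  let ?A = "Poly_Mapping.keys d \<union> Poly_Mapping.keys e"
  have "(\<Prod>v\<in>Poly_Mapping.keys f. g v ^ Poly_Mapping.lookup f v) =
      (\<Prod>v\<in>?A. g v ^ Poly_Mapping.lookup f v)" if "Poly_Mapping.keys f \<subseteq> ?A" for f
    by (rule prod.mono_neutral_left) (use that in \<open>auto simp: in_keys_iff\<close>)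
  then show ?thesis
    by (simp add: keys_add_nat lookup_add power_add prod.distrib)
qed

lemma mpoly_eval_add: "mpoly_eval g (p + q) = mpoly_eval g p + mpoly_eval g q"
  unfolding mpoly_eval_def
  by (rule setsum_keys_plus_distrib) (auto simp: smult_add_left)

lemma mpoly_eval_0 [simp]: "mpoly_eval g 0 = 0"
  by (simp add: mpoly_eval_def)

lemma mpoly_eval_sum: "mpoly_eval g (sum p I) = (\<Sum>i\<in>I. mpoly_eval g (p i))"
  by (induction I rule: infinite_finite_induct) (auto simp: mpoly_eval_add)

lemma mpoly_eval_diff: "mpoly_eval g (p - q) = mpoly_eval g p - mpoly_eval g q"
  by (metis add_diff_cancel diff_add_cancel mpoly_eval_add)

lemma mpoly_eval_single:
  "mpoly_eval g (Poly_Mapping.single e c) =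
    smult c (\<Prod>v\<in>Poly_Mapping.keys e. g v ^ Poly_Mapping.lookup e v)"
  by (simp add: mpoly_eval_def)

lemma mpoly_eval_mult: "mpoly_eval g (p * q) = mpoly_eval g p * mpoly_eval g q"
proof -
  have "p * q = (\<Sum>d\<in>Poly_Mapping.keys p. \<Sum>e\<in>Poly_Mapping.keys q.
      Poly_Mapping.single (d + e) (Poly_Mapping.lookup p d * Poly_Mapping.lookup q e))"
    by (subst (1) sum_single_lookup[of p, symmetric], subst (1) sum_single_lookup[of q, symmetric])
      (simp add: sum_product mult_single)
  also have "mpoly_eval g \<dots> = mpoly_eval g p * mpoly_eval g q"
    by (simp add: mpoly_eval_sum mpoly_eval_single prod_power_add mpoly_eval_def[of g p]
        mpoly_eval_def[of g q] sum_product mult.commute)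
  finally show ?thesis .
qed

lemma mpoly_eval_MConst [simp]: "mpoly_eval g (MConst c) = [:c:]"
  by (simp add: MConst_def mpoly_eval_single)

lemma mpoly_eval_MVar [simp]: "mpoly_eval g (MVar v) = g v"
  by (simp add: MVar_def mpoly_eval_single)

lemma mpoly_eval_MConst_mult: "mpoly_eval g (MConst c * P) = smult c (mpoly_eval g P)"
  by (simp add: mpoly_eval_mult)

lemma mpoly_eval_1 [simp]: "mpoly_eval g 1 = 1"
  by (metis MConst_1 mpoly_eval_MConst one_pCons)

lemma mpoly_eval_power: "mpoly_eval g (p ^ n) = mpoly_eval g p ^ n"
  by (induction n) (auto simp: mpoly_eval_mult)

lemma mpoly_eval_prod: "mpoly_eval g (prod p I) = (\<Prod>i\<in>I. mpoly_eval g (p i))"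
  by (induction I rule: infinite_finite_induct) (auto simp: mpoly_eval_mult)

lemma generator_in_mpoly_ideal:
  assumes "r \<in> R"
  shows "r \<in> mpoly_ideal V R"
  unfolding mpoly_ideal_def
  by (rule CollectI, rule exI[of _ "{r}"], rule exI[of _ "\<lambda>_. 1"]) (use assms in auto)

lemma zero_in_mpoly_ideal [simp]: "0 \<in> mpoly_ideal V R"
  unfolding mpoly_ideal_def by (rule CollectI, rule exI[of _ "{}"]) auto

lemma add_in_mpoly_ideal:
  assumes "p \<in> mpoly_ideal V R" "q \<in> mpoly_ideal V R"
  shows "p + q \<in> mpoly_ideal V R"
proof -
  obtain T h where T: "p = (\<Sum>r\<in>T. h r * r)" "finite T" "T \<subseteq> R" "\<forall>r\<in>T. h r \<in> mpolys_in V"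
    using assms(1) by (auto simp: mpoly_ideal_def)
  obtain U k where U: "q = (\<Sum>r\<in>U. k r * r)" "finite U" "U \<subseteq> R" "\<forall>r\<in>U. k r \<in> mpolys_in V"
    using assms(2) by (auto simp: mpoly_ideal_def)
  define h' where "h' r = (if r \<in> T then h r else 0)" for r
  define k' where "k' r = (if r \<in> U then k r else 0)" for r
  have "p = (\<Sum>r\<in>T \<union> U. h' r * r)" "q = (\<Sum>r\<in>T \<union> U. k' r * r)"
    unfolding T U h'_def k'_def using T(2) U(2)
    by (auto intro!: sum.mono_neutral_cong_left)
  then have "p + q = (\<Sum>r\<in>T \<union> U. (h' r + k' r) * r)"
    by (simp add: sum.distrib distrib_right)
  moreover have "\<forall>r\<in>T \<union> U. h' r + k' r \<in> mpolys_in V"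
    using T U by (auto simp: h'_def k'_def intro!: add_in_mpolys_in)
  ultimately show ?thesis
    unfolding mpoly_ideal_def using T U by (intro CollectI exI[of _ "T \<union> U"] exI conjI) auto
qed

lemma mult_in_mpoly_ideal:
  assumes "p \<in> mpolys_in V" "q \<in> mpoly_ideal V R"
  shows "p * q \<in> mpoly_ideal V R"
proof -
  obtain T h where T: "q = (\<Sum>r\<in>T. h r * r)" "finite T" "T \<subseteq> R" "\<forall>r\<in>T. h r \<in> mpolys_in V"
    using assms(2) by (auto simp: mpoly_ideal_def)
  have "p * q = (\<Sum>r\<in>T. (p * h r) * r)"
    unfolding T by (simp add: sum_distrib_left mult.assoc)
  moreover have "\<forall>r\<in>T. p * h r \<in> mpolys_in V"
    using T assms(1) by (auto intro!: mult_in_mpolys_in)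
  ultimately show ?thesis
    unfolding mpoly_ideal_def using T by (intro CollectI exI[of _ T] exI conjI) auto
qed

lemma mpoly_ideal_subset: "R \<subseteq> mpolys_in V \<Longrightarrow> mpoly_ideal V R \<subseteq> mpolys_in V"
  by (force simp: mpoly_ideal_def intro!: sum_in_mpolys_in mult_in_mpolys_in)

lemma mpoly_eval_ideal:
  assumes "\<And>r. r \<in> R \<Longrightarrow> mpoly_eval g r = 0" "p \<in> mpoly_ideal V R"
  shows "mpoly_eval g p = 0"
proof -
  obtain T h where "p = (\<Sum>r\<in>T. h r * r)" "T \<subseteq> R"
    using assms(2) by (auto simp: mpoly_ideal_def)
  then show ?thesis
    using assms(1) by (force simp: mpoly_eval_sum mpoly_eval_mult intro!: sum.neutral)
qed

section \<open>Bracket expressions\<close>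

lemma poly_monom_induct [case_names monom add]:
  assumes "\<And>c n. Q (monom c n)" "\<And>p q. Q p \<Longrightarrow> Q q \<Longrightarrow> Q (p + q)"
  shows "Q p"
proof -
  have "Q (\<Sum>n<k. monom (coeff p n) n)" for k
    using assms(1)[of 0 0] by (induction k) (auto intro: assms)
  from this[of "Suc (degree p)"] show ?thesis
    by (simp only: lessThan_Suc_atMost poly_as_sum_of_monoms)
qed

lemma poly_map_poly_MConst:
  assumes "degree q \<le> D"
  shows "poly (map_poly MConst q) x = (\<Sum>k\<le>D. MConst (coeff q k) * x ^ k)"
proof -
  have "poly (map_poly MConst q) x = (\<Sum>k\<le>degree q. MConst (coeff q k) * x ^ k)"
    by (simp add: poly_altdef degree_map_poly coeff_map_poly)
  also have "\<dots> = (\<Sum>k\<le>D. MConst (coeff q k) * x ^ k)"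
    using assms by (intro sum.mono_neutral_left) (auto simp: coeff_eq_0)
  finally show ?thesis .
qed

lemma poly_map_poly_MConst_add:
  "poly (map_poly MConst (p + q)) x = poly (map_poly MConst p) x + poly (map_poly MConst q) x"
proof -
  define D where "D = max (degree p) (degree q)"
  have "degree p \<le> D" "degree q \<le> D" "degree (p + q) \<le> D"
    using degree_add_le_max[of p q] by (auto simp: D_def)
  then show ?thesis
    by (simp add: poly_map_poly_MConst MConst_add distrib_right sum.distrib)
qed

lemma poly_map_poly_MConst_monom:
  "poly (map_poly MConst (monom c n)) x = MConst c * x ^ n"
  using poly_map_poly_MConst[OF degree_monom_le, of c n x]
  by (simp add: if_distrib[of MConst] if_distrib[of "\<lambda>y. y * _"] cong: if_cong)

lemma bracket_add: "bracket m (p + q) = bracket m p + bracket m q"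
  by (rule poly_eqI) (simp add: coeff_bracket)

lemma bracket_0 [simp]: "bracket m 0 = 0"
  by (rule poly_eqI) (simp add: coeff_bracket)

lemma bracket_monom: "bracket m (monom c n) = (if n < m then 0 else monom c n)"
  by (rule poly_eqI) (auto simp: coeff_bracket)

lemma bracket_eq_self: "(\<And>k. k < m \<Longrightarrow> coeff p k = 0) \<Longrightarrow> bracket m p = p"
  by (rule poly_eqI) (auto simp: coeff_bracket)

lemma bracket_monom_mult: "m \<le> n \<Longrightarrow> bracket m (monom c n * p) = monom c n * p"
  by (rule bracket_eq_self) (simp add: coeff_monom_mult)

lemma bracket_expr_cong:
  assumes "m > 0" "bracket m p = bracket m q"
  shows "bracket_expr m p = bracket_expr m q"
proof -
  have "bracket_coeff m p i = bracket_coeff m q i" for i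
  proof (rule poly_eqI)
    fix k
    have "coeff p (m * k + (m + i)) = coeff q (m * k + (m + i))"
      using arg_cong[OF assms(2), of "\<lambda>r. coeff r (m * k + (m + i))"]
      by (simp add: coeff_bracket)
    then show "coeff (bracket_coeff m p i) k = coeff (bracket_coeff m q i) k"
      using assms(1) by (simp add: coeff_bracket_coeff)
  qed
  then show ?thesis by (simp add: bracket_expr_def)
qed

lemma bracket_expr_add:
  assumes "m > 0"
  shows "bracket_expr m (p + q) = bracket_expr m p + bracket_expr m q"
proof -
  have "bracket_coeff m (p + q) i = bracket_coeff m p i + bracket_coeff m q i" for i
    using assms by (intro poly_eqI) (simp add: coeff_bracket_coeff)
  then show ?thesis
    by (simp add: bracket_expr_def poly_map_poly_MConst_add distrib_right sum.distrib)
qed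

lemma bracket_expr_0 [simp]: "m > 0 \<Longrightarrow> bracket_expr m 0 = 0"
  using bracket_expr_add[of m 0 0] by simp

lemma bracket_expr_monom:
  assumes "m > 0" "n \<ge> m"
  shows "bracket_expr m (monom c n) =
    MConst c * MVar (GenX 0) ^ (n div m - 1) * MVar (GenX (n mod m))"
proof -
  have eq: "bracket_coeff m (monom c n) i = (if i = n mod m then monom c (n div m - 1) else 0)"
    if "i < m" for i
  proof (rule poly_eqI)
    fix k
    have "m * k + (m + i) = n \<longleftrightarrow> i = n mod m \<and> k = n div m - 1"
    proof
      assume "m * k + (m + i) = n"
      then have n: "n = i + m * Suc k" by simp
      have "n mod m = i" "n div m = Suc k"
        unfolding n using that by (simp_all only: mod_mult_self2 div_mult_self2 mod_less div_less)
      then show "i = n mod m \<and> k = n div m - 1" by simp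
    next
      assume *: "i = n mod m \<and> k = n div m - 1"
      have "n div m = Suc k"
        using * assms by (simp add: div_greater_zero_iff)
      moreover have "n = m * (n div m) + n mod m" by simp
      ultimately have "n = m * Suc k + i" using * by metis
      then show "m * k + (m + i) = n" by simp
    qed
    then show "coeff (bracket_coeff m (monom c n) i) k =
        coeff (if i = n mod m then monom c (n div m - 1) else 0) k"
      using assms by (auto simp: coeff_bracket_coeff)
  qed
  have "bracket_expr m (monom c n) =
      (\<Sum>i<m. if i = n mod m then MConst c * MVar (GenX 0) ^ (n div m - 1) * MVar (GenX i) else 0)"
    unfolding bracket_expr_def
    by (rule sum.cong) (auto simp: eq poly_map_poly_MConst_monom)
  then show ?thesis
    using assms by (simp add: sum.delta)
qed

lemma bracket_expr_smult:
  assumes "m > 0"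
  shows "bracket_expr m (smult c p) = MConst c * bracket_expr m p"
proof (induction p rule: poly_monom_induct)
  case (monom d n)
  have "bracket_expr m (monom d n) = 0" if "n < m" for d :: 'a
    using bracket_expr_cong[of m "monom d n" 0] assms that by (simp add: bracket_monom)
  then show ?case
    using assms by (cases "n < m") (simp_all add: smult_monom bracket_expr_monom MConst_mult mult.assoc)
next
  case (add p q)
  with assms show ?case by (simp add: smult_add_right bracket_expr_add distrib_left)
qed

lemma bracket_expr_monom_mult:
  assumes "m > 0"
  shows "bracket_expr m (monom 1 (m * k) * bracket m p) = MVar (GenX 0) ^ k * bracket_expr m p"
proof (induction p rule: poly_monom_induct)
  case (monom c n)
  show ?case
  proof (cases "n < m")
    case True
    then show ?thesis
      using assms bracket_expr_cong[of m "monom c n" 0] by (simp add: bracket_monom)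
  next
    case False
    have "(m * k + n) div m - 1 = k + (n div m - 1)"
      using False assms div_greater_zero_iff[of n m] by simp
    with False show ?thesis
      using assms by (simp add: bracket_monom mult_monom bracket_expr_monom power_add mult_ac)
  qed
next
  case (add p q)
  with assms show ?case by (simp add: bracket_add distrib_left bracket_expr_add)
qed

lemma bracket_expr_in_mpolys_in:
  "m > 0 \<Longrightarrow> bracket_expr m p \<in> mpolys_in (gens m \<Gamma>)"
  by (auto simp: bracket_expr_def poly_map_poly_MConst[OF order_refl] gens_def
      intro!: sum_in_mpolys_in mult_in_mpolys_in power_in_mpolys_in)

lemma mpoly_eval_bracket_expr:
  assumes "m > 0"
  shows "mpoly_eval (gen_val m A) (bracket_expr m p) = bracket m p"
proof -
  have "mpoly_eval (gen_val m A) (bracket_expr m p) =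
      (\<Sum>i<m. pcompose (bracket_coeff m p i) (monom 1 m) * monom 1 (m + i))"
    by (simp add: bracket_expr_def poly_map_poly_MConst[OF order_refl] mpoly_eval_sum
        mpoly_eval_mult mpoly_eval_power pcompose_altdef poly_altdef degree_map_poly coeff_map_poly)
  then show ?thesis by (simp add: bracket_decomp[OF assms])
qed

section \<open>Weights of exponent vectors\<close>

lemma SS_finite: "\<Gamma> \<in> SS m \<Longrightarrow> finite \<Gamma>"
  by (auto simp: SS_def intro: finite_subset)

lemma SS_bounds: "\<Gamma> \<in> SS m \<Longrightarrow> \<gamma> \<in> \<Gamma> \<Longrightarrow> 0 < \<gamma> \<and> \<gamma> < m - 1"
proof -
  assume "\<Gamma> \<in> SS m" "\<gamma> \<in> \<Gamma>"
  then have "\<gamma> \<in> {2..m - 2}" unfolding SS_def by blast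
  then show ?thesis by auto
qed

lemma SS_add: "\<Gamma> \<in> SS m \<Longrightarrow> \<alpha> \<in> \<Gamma> \<Longrightarrow> \<beta> \<in> \<Gamma> \<Longrightarrow> \<alpha> + \<beta> < m \<Longrightarrow> \<alpha> + \<beta> \<in> \<Gamma>"
  unfolding SS_def by (metis (mono_tags, lifting) CollectD Un_iff atLeast_iff leD)

lemma ind_subset: "ind \<Gamma> \<subseteq> \<Gamma>"
  by (auto simp: ind_def)

lemma nu_in_ind:
  assumes "finite \<Gamma>" "i < card (ind \<Gamma>)"
  shows "nu \<Gamma> i \<in> ind \<Gamma>"
proof -
  have "finite (ind \<Gamma>)" using assms(1) ind_subset finite_subset by blast
  then show ?thesis
    using assms(2) nth_mem[of i "sorted_list_of_set (ind \<Gamma>)"] by (simp add: nu_def)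
qed

lemma ex_nu:
  assumes "finite \<Gamma>" "\<gamma> \<in> ind \<Gamma>"
  shows "\<exists>i<card (ind \<Gamma>). nu \<Gamma> i = \<gamma>"
proof -
  have "finite (ind \<Gamma>)" using assms(1) ind_subset finite_subset by blast
  then show ?thesis
    using assms(2) by (metis in_set_conv_nth length_sorted_list_of_set nu_def set_sorted_list_of_set)
qed

lemma nu_inj:
  assumes "i < card (ind \<Gamma>)" "j < card (ind \<Gamma>)" "nu \<Gamma> i = nu \<Gamma> j"
  shows "i = j"
  using assms nth_eq_iff_index_eq[of "sorted_list_of_set (ind \<Gamma>)" i j] by (simp add: nu_def)

lemma wt_0 [simp]: "wt \<Gamma> 0 = 0"
  by (simp add: wt_def)

lemma wt_add: "wt \<Gamma> (a + b) = wt \<Gamma> a + wt \<Gamma> b"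
  by (simp add: wt_def lookup_add distrib_right sum.distrib)

lemma wt_single: "i < card (ind \<Gamma>) \<Longrightarrow> wt \<Gamma> (Poly_Mapping.single i 1) = nu \<Gamma> i"
  by (simp add: wt_def lookup_single when_mult) (simp add: when_def)

lemma zero_in_expvecs [simp]: "0 \<in> expvecs s"
  by (simp add: expvecs_def)

lemma single_in_expvecs [simp]: "i < s \<Longrightarrow> Poly_Mapping.single i n \<in> expvecs s"
  by (auto simp: expvecs_def)

lemma add_in_expvecs: "a \<in> expvecs s \<Longrightarrow> b \<in> expvecs s \<Longrightarrow> a + b \<in> expvecs s"
  using keys_add[of a b] by (auto simp: expvecs_def)

lemma expvecs_split:
  assumes "a \<in> expvecs s" "a \<noteq> 0"
  shows "\<exists>i<s. \<exists>b\<in>expvecs s. a = Poly_Mapping.single i 1 + b"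
proof -
  obtain i where i: "i \<in> Poly_Mapping.keys a"
    using assms(2) by (metis equals0I keys_eq_empty)
  define b where "b = a - Poly_Mapping.single i 1"
  have "a = Poly_Mapping.single i 1 + b"
    using i by (intro poly_mapping_eqI)
      (auto simp: b_def lookup_add lookup_minus lookup_single when_def in_keys_iff)
  moreover have "Poly_Mapping.keys b \<subseteq> Poly_Mapping.keys a"
    by (auto simp: b_def in_keys_iff lookup_minus)
  ultimately show ?thesis
    using assms(1) i by (auto simp: expvecs_def)
qed

lemma wt_pos:
  assumes "\<Gamma> \<in> SS m" "a \<in> expvecs (card (ind \<Gamma>))" "a \<noteq> 0"
  shows "0 < wt \<Gamma> a"
proof -
  obtain i b where "i < card (ind \<Gamma>)" "a = Poly_Mapping.single i 1 + b"
    using expvecs_split[OF assms(2,3)] by blast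
  moreover have "0 < nu \<Gamma> i" if "i < card (ind \<Gamma>)"
    using nu_in_ind[OF SS_finite[OF assms(1)] that] ind_subset SS_bounds[OF assms(1)] by blast
  ultimately show ?thesis by (simp only: wt_add wt_single) simp
qed

lemma wt_in_SS:
  assumes "\<Gamma> \<in> SS m" "a \<in> expvecs (card (ind \<Gamma>))" "a \<noteq> 0" "wt \<Gamma> a < m"
  shows "wt \<Gamma> a \<in> \<Gamma>"
  using assms(2-)
proof (induction "wt \<Gamma> a" arbitrary: a rule: less_induct)
  case less
  obtain i b where i: "i < card (ind \<Gamma>)" and b: "b \<in> expvecs (card (ind \<Gamma>))"
    and a: "a = Poly_Mapping.single i 1 + b"
    using expvecs_split[OF less.prems(1,2)] by blast
  have nu: "nu \<Gamma> i \<in> \<Gamma>"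
    using nu_in_ind[OF SS_finite[OF assms(1)] i] ind_subset by blast
  have wt: "wt \<Gamma> a = nu \<Gamma> i + wt \<Gamma> b"
    unfolding a by (simp only: wt_add wt_single[OF i])
  show ?case
  proof (cases "b = 0")
    case True
    then show ?thesis using wt nu by simp
  next
    case False
    have "wt \<Gamma> b < wt \<Gamma> a"
      using wt SS_bounds[OF assms(1) nu] by simp
    then have "wt \<Gamma> b \<in> \<Gamma>"
      using less.hyps b False less.prems(3) by force
    then show ?thesis
      using SS_add[OF assms(1) nu] less.prems(3) unfolding wt by blast
  qed
qed

lemma wt_less_iff:
  assumes "\<Gamma> \<in> SS m" "a \<in> expvecs (card (ind \<Gamma>))" "m > 1"
  shows "wt \<Gamma> a < m \<longleftrightarrow> wt \<Gamma> a < m - 1"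
proof (cases "a = 0")
  case True
  then show ?thesis using assms by simp
next
  case False
  show ?thesis
    using wt_in_SS[OF assms(1,2) False] SS_bounds[OF assms(1), of "wt \<Gamma> a"] by linarith
qed

lemma ex_expvec_wt:
  assumes "finite \<Gamma>" "0 \<notin> \<Gamma>" "\<gamma> \<in> \<Gamma>"
  shows "\<exists>a\<in>expvecs (card (ind \<Gamma>)). wt \<Gamma> a = \<gamma>"
  using assms(3)
proof (induction \<gamma> rule: less_induct)
  case (less \<gamma>)
  show ?case
  proof (cases "\<gamma> \<in> dec \<Gamma>")
    case True
    then obtain \<alpha> \<beta> where *: "\<alpha> \<in> \<Gamma>" "\<beta> \<in> \<Gamma>" "\<gamma> = \<alpha> + \<beta>"
      by (auto simp: dec_def)
    then have "\<alpha> < \<gamma>" "\<beta> < \<gamma>" using assms(2) by (auto intro: gr0I)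
    then obtain a b where "a \<in> expvecs (card (ind \<Gamma>))" "wt \<Gamma> a = \<alpha>"
      "b \<in> expvecs (card (ind \<Gamma>))" "wt \<Gamma> b = \<beta>"
      using less.IH[of \<alpha>] less.IH[of \<beta>] * by blast
    then show ?thesis using * by (intro bexI[of _ "a + b"] add_in_expvecs) (simp_all add: wt_add)
  next
    case False
    then have "\<gamma> \<in> ind \<Gamma>" using less.prems by (simp add: ind_def)
    then obtain i where "i < card (ind \<Gamma>)" "nu \<Gamma> i = \<gamma>"
      using ex_nu[OF assms(1)] by blast
    then show ?thesis
      by (intro bexI[of _ "Poly_Mapping.single i 1"]) (simp only: wt_single, simp)
  qed
qed

lemma finite_Rel:
  assumes "\<Gamma> \<in> SS m"
  shows "finite (Rel \<Gamma> \<gamma>)"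
proof -
  let ?s = "card (ind \<Gamma>)"
  have "Poly_Mapping.lookup a i \<le> \<gamma>" if "a \<in> Rel \<Gamma> \<gamma>" "i < ?s" for a i
  proof -
    have "0 < nu \<Gamma> i"
      using nu_in_ind[OF SS_finite[OF assms] that(2)] ind_subset SS_bounds[OF assms] by blast
    then have "Poly_Mapping.lookup a i \<le> Poly_Mapping.lookup a i * nu \<Gamma> i" by simp
    also have "\<dots> \<le> wt \<Gamma> a"
      unfolding wt_def using that(2)
      by (intro member_le_sum[of i "{..<?s}" "\<lambda>i. Poly_Mapping.lookup a i * nu \<Gamma> i"]) auto
    finally show ?thesis using that(1) by (simp add: Rel_def)
  qed
  then have "Poly_Mapping.lookup ` Rel \<Gamma> \<gamma> \<subseteq>
      {f. \<forall>i. (i \<in> {..<?s} \<longrightarrow> f i \<in> {..\<gamma>}) \<and> (i \<notin> {..<?s} \<longrightarrow> f i = 0)}"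
    by (auto simp: Rel_def expvecs_def in_keys_iff subset_iff)
  then have "finite (Poly_Mapping.lookup ` Rel \<Gamma> \<gamma>)"
    by (rule finite_subset) (rule finite_set_of_finite_funs, auto)
  then show ?thesis
    by (rule finite_imageD) (rule inj_onI, rule poly_mapping_eqI, simp)
qed

lemma expvec_wt_ind:
  assumes "\<Gamma> \<in> SS m" "a \<in> expvecs (card (ind \<Gamma>))" "wt \<Gamma> a \<in> ind \<Gamma>"
  shows "\<exists>i<card (ind \<Gamma>). a = Poly_Mapping.single i 1 \<and> nu \<Gamma> i = wt \<Gamma> a"
proof -
  have bounds: "0 < wt \<Gamma> a" "wt \<Gamma> a < m - 1"
    using SS_bounds[OF assms(1)] assms(3) ind_subset by blast+
  then have "a \<noteq> 0" by auto
  then obtain i b where i: "i < card (ind \<Gamma>)" and b: "b \<in> expvecs (card (ind \<Gamma>))"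
    and a: "a = Poly_Mapping.single i 1 + b"
    using expvecs_split[OF assms(2)] by blast
  have wt: "wt \<Gamma> a = nu \<Gamma> i + wt \<Gamma> b"
    unfolding a by (simp only: wt_add wt_single[OF i])
  have nu: "nu \<Gamma> i \<in> \<Gamma>"
    using nu_in_ind[OF SS_finite[OF assms(1)] i] ind_subset by blast
  have "b = 0"
  proof (rule ccontr)
    assume "b \<noteq> 0"
    then have "wt \<Gamma> b \<in> \<Gamma>"
      using wt_in_SS[OF assms(1) b] wt bounds by simp
    then have "wt \<Gamma> a \<in> dec \<Gamma>"
      using wt nu assms(3) ind_subset unfolding dec_def by blast
    then show False using assms(3) by (simp add: ind_def)
  qed
  then show ?thesis using i a wt by auto
qed

lemma expvec_wt_unique:
  assumes "\<Gamma> \<in> SS m" "dec_ge2 \<Gamma> = {}"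
    and a: "a \<in> expvecs (card (ind \<Gamma>))" and b: "b \<in> expvecs (card (ind \<Gamma>))"
    and "wt \<Gamma> a = wt \<Gamma> b" "wt \<Gamma> a < m"
  shows "a = b"
proof (cases "a = 0 \<or> b = 0")
  case True
  then have "wt \<Gamma> a = 0" "wt \<Gamma> b = 0" using assms(5) by auto
  then show ?thesis using wt_pos[OF assms(1) a] wt_pos[OF assms(1) b] by auto
next
  case False
  then have mem: "wt \<Gamma> a \<in> \<Gamma>"
    using wt_in_SS[OF assms(1) a] assms(6) by blast
  show ?thesis
  proof (cases "wt \<Gamma> a \<in> dec \<Gamma>")
    case True
    then have "card (Rel \<Gamma> (wt \<Gamma> a)) \<le> Suc 0"
      using assms(2) unfolding dec_ge2_def by (metis (mono_tags, lifting) One_nat_def Suc_1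
          empty_iff mem_Collect_eq not_less_eq_eq)
    moreover have "a \<in> Rel \<Gamma> (wt \<Gamma> a)" "b \<in> Rel \<Gamma> (wt \<Gamma> a)"
      using a b assms(5) by (auto simp: Rel_def)
    ultimately show ?thesis
      using card_le_Suc0_iff_eq[OF finite_Rel[OF assms(1)]] by blast
  next
    case False
    then have "wt \<Gamma> a \<in> ind \<Gamma>" using mem by (simp add: ind_def)
    then obtain i where i: "i < card (ind \<Gamma>)" "a = Poly_Mapping.single i 1" "nu \<Gamma> i = wt \<Gamma> a"
      using expvec_wt_ind[OF assms(1) a] by blast
    obtain j where j: "j < card (ind \<Gamma>)" "b = Poly_Mapping.single j 1" "nu \<Gamma> j = wt \<Gamma> b"
      using \<open>wt \<Gamma> a \<in> ind \<Gamma>\<close> expvec_wt_ind[OF assms(1) b] unfolding assms(5) by blast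
    have "nu \<Gamma> i = nu \<Gamma> j" unfolding i(3) j(3) by (rule assms(5))
    then have "i = j" by (rule nu_inj[OF i(1) j(1)])
    then show ?thesis unfolding i(2) j(2) by simp
  qed
qed

lemma Nideal_split:
  assumes "\<Gamma> \<in> SS m" "a \<in> Nideal n \<Gamma>"
  shows "\<exists>c\<in>ind_Nideal n \<Gamma>. \<exists>d\<in>expvecs (card (ind \<Gamma>)). a = c + d"
  using assms(2)
proof (induction "wt \<Gamma> a" arbitrary: a rule: less_induct)
  case less
  show ?case
  proof (cases "a \<in> ind_Nideal n \<Gamma>")
    case True
    then show ?thesis by (metis add.right_neutral zero_in_expvecs)
  next
    case False
    then obtain c d where *: "c \<in> Nideal n \<Gamma>" "d \<in> expvecs (card (ind \<Gamma>))" "d \<noteq> 0" "a = c + d"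
      using less.prems by (auto simp: ind_Nideal_def)
    then have "wt \<Gamma> c < wt \<Gamma> a"
      using wt_pos[OF assms(1)] by (simp add: wt_add)
    from less.hyps[OF this *(1)] obtain c' d' where
      "c' \<in> ind_Nideal n \<Gamma>" "d' \<in> expvecs (card (ind \<Gamma>))" "c = c' + d'" by blast
    then show ?thesis
      using * by (intro bexI[of _ c'] bexI[of _ "d' + d"]) (auto simp: add.assoc intro: add_in_expvecs)
  qed
qed

section \<open>The canonical basis\<close>

definition starts_at :: "nat \<Rightarrow> 'a::comm_ring_1 poly \<Rightarrow> bool" where
  "starts_at n p \<longleftrightarrow> (\<forall>k<n. coeff p k = 0) \<and> coeff p n = 1"

lemma starts_at_mult:
  assumes "starts_at a p" "starts_at b q"
  shows "starts_at (a + b) (p * q)"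
proof -
  have "coeff (p * q) k = (if k = a + b then 1 else 0)" if "k \<le> a + b" for k
  proof -
    have "coeff p i * coeff q (k - i) = (if i = a \<and> k = a + b then 1 else 0)" if "i \<le> k" for i
    proof -
      consider "i < a" | "k - i < b" | "i = a" "k = a + b"
        using \<open>i \<le> k\<close> \<open>k \<le> a + b\<close> by linarith
      then show ?thesis using assms by cases (auto simp: starts_at_def)
    qed
    then have "coeff (p * q) k = (\<Sum>i\<le>k. if i = a \<and> k = a + b then 1 else 0)"
      unfolding coeff_mult by (intro sum.cong) auto
    also have "\<dots> = (if k = a + b then 1 else 0)" by (auto simp: sum.delta)
    finally show ?thesis .
  qed
  then show ?thesis by (simp add: starts_at_def)
qed

lemma starts_at_1 [simp]: "starts_at 0 1"
  by (simp add: starts_at_def)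

lemma starts_at_power: "starts_at a p \<Longrightarrow> starts_at (k * a) (p ^ k)"
  by (induction k) (auto intro: starts_at_mult)

lemma starts_at_prod:
  "(\<And>i. i \<in> I \<Longrightarrow> starts_at (a i) (p i)) \<Longrightarrow> starts_at (sum a I) (prod p I)"
  by (induction I rule: infinite_finite_induct) (auto intro: starts_at_mult)

lemma starts_at_iff: "starts_at n p \<longleftrightarrow> (\<exists>q. p = monom 1 n + monom 1 (Suc n) * q)"
proof
  assume p: "starts_at n p"
  have "coeff (p - monom 1 n) k = 0" if "k < Suc n" for k
    using p that by (cases "k = n") (auto simp: starts_at_def)
  then have "monom 1 (Suc n) dvd p - monom 1 n"
    by (simp add: monom_1_dvd_iff')
  then obtain q where "p - monom 1 n = monom 1 (Suc n) * q" by (elim dvdE)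
  then show "\<exists>q. p = monom 1 n + monom 1 (Suc n) * q"
    by (metis add.commute diff_add_cancel)
qed (auto simp: starts_at_def coeff_monom_mult)

lemma coeffs_eq_0_if_starts_at:
  assumes "finite I" "inj_on d I" "\<And>i. i \<in> I \<Longrightarrow> starts_at (d i) (g i)"
    and "\<And>i. i \<in> I \<Longrightarrow> coeff (\<Sum>j\<in>I. smult (u j) (g j)) (d i) = 0"
    and "i \<in> I"
  shows "u i = 0"
  using \<open>i \<in> I\<close>
proof (induction "d i" arbitrary: i rule: less_induct)
  case less
  have "u j * coeff (g j) (d i) = (if j = i then u i else 0)" if "j \<in> I" for j
  proof -
    consider "d j < d i" | "d i < d j" | "d i = d j" by linarith
    then show ?thesis
    proof cases
      case 1
      then show ?thesis using less.hyps that by auto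
    next
      case 2
      then show ?thesis using assms(3)[OF that] by (auto simp: starts_at_def)
    next
      case 3
      then have "j = i" using assms(2) that less.prems by (auto dest: inj_onD)
      then show ?thesis using assms(3)[OF that] by (simp add: starts_at_def)
    qed
  qed
  then have "(\<Sum>j\<in>I. u j * coeff (g j) (d i)) = u i"
    using assms(1) less.prems by (simp add: sum.delta)
  then show ?case using assms(4)[OF less.prems] by (simp add: coeff_sum)
qed

interpretation polys: module "smult :: 'k::comm_ring_1 \<Rightarrow> 'k poly \<Rightarrow> 'k poly"
  by unfold_locales (simp_all add: smult_add_right smult_add_left)

lemma independent_starts_at:
  fixes S :: "'k::comm_ring_1 poly set"
  assumes "inj_on d S" "\<And>p. p \<in> S \<Longrightarrow> starts_at (d p) p"
  shows "\<not> module.dependent smult S"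
proof
  assume "module.dependent smult S"
  then obtain T u where T: "finite T" "T \<subseteq> S" "(\<Sum>v\<in>T. smult (u v) v) = 0" "\<exists>v\<in>T. u v \<noteq> 0"
    unfolding polys.dependent_explicit by blast
  have "u v = 0" if "v \<in> T" for v
    by (rule coeffs_eq_0_if_starts_at[of T d "\<lambda>v. v" u])
      (use T assms that in \<open>auto intro: inj_on_subset\<close>)
  with T(4) show False by blast
qed

context
  fixes A :: "'k::field poly set" and m :: nat
  assumes A: "A \<in> AA m"
begin

lemma m_pos: "m > 0"
proof (rule ccontr)
  assume "\<not> m > 0"
  then have "monom 1 (m - 1) = (monom 1 m :: 'k poly)" by simp
  moreover have "monom 1 m * 1 \<in> A" "monom 1 (m - 1) \<notin> A"
    using A unfolding AA_def by blast+
  ultimately show False by simp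
qed

lemma one_in_A: "1 \<in> A"
  and add_in_A: "p \<in> A \<Longrightarrow> q \<in> A \<Longrightarrow> p + q \<in> A"
  and mult_in_A: "p \<in> A \<Longrightarrow> q \<in> A \<Longrightarrow> p * q \<in> A"
  and smult_in_A: "p \<in> A \<Longrightarrow> smult c p \<in> A"
  using A by (auto simp: AA_def is_subalgebra_def)

lemma diff_in_A: "p \<in> A \<Longrightarrow> q \<in> A \<Longrightarrow> p - q \<in> A"
  using add_in_A[of p "smult (-1) q"] smult_in_A[of q "-1"] by simp

lemma zero_in_A: "0 \<in> A"
  using smult_in_A[OF one_in_A, of 0] by simp

lemma sum_in_A: "(\<And>i. i \<in> I \<Longrightarrow> p i \<in> A) \<Longrightarrow> sum p I \<in> A"
  by (induction I rule: infinite_finite_induct) (auto intro: add_in_A zero_in_A)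

lemma prod_in_A: "(\<And>i. i \<in> I \<Longrightarrow> p i \<in> A) \<Longrightarrow> prod p I \<in> A"
  by (induction I rule: infinite_finite_induct) (auto intro: mult_in_A one_in_A)

lemma power_in_A: "p \<in> A \<Longrightarrow> p ^ n \<in> A"
  by (induction n) (auto intro: mult_in_A one_in_A)

lemma conductor_in_A:
  assumes "\<And>k. k < m \<Longrightarrow> coeff p k = 0"
  shows "p \<in> A"
proof -
  have "monom 1 m dvd p" using assms by (simp add: monom_1_dvd_iff')
  then show ?thesis using A by (auto simp: AA_def elim: dvdE)
qed

lemma poly_cutoff_in_A: "p \<in> A \<Longrightarrow> poly_cutoff m p \<in> A"
  using diff_in_A[of p "p - poly_cutoff m p"] conductor_in_A[of "p - poly_cutoff m p"]
  by (simp add: coeff_poly_cutoff)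

lemma Gam_iff: "\<gamma> \<in> Gam m A \<longleftrightarrow> 0 < \<gamma> \<and> \<gamma> < m \<and> (\<exists>p\<in>A. starts_at \<gamma> p)"
  using m_pos by (auto simp: Gam_def starts_at_iff)

lemma finite_Gam: "finite (Gam m A)"
  by (simp add: Gam_def)

lemma coeff_eq_0_outside_Gam:
  assumes "p \<in> A" "coeff p 0 = 0" "\<And>\<gamma>. \<gamma> \<in> Gam m A \<Longrightarrow> coeff p \<gamma> = 0" "n < m"
  shows "coeff p n = 0"
  using assms(4)
proof (induction n rule: less_induct)
  case (less n)
  show ?case
  proof (rule ccontr)
    assume n: "coeff p n \<noteq> 0"
    then have "starts_at n (smult (inverse (coeff p n)) p)"
      using less by (auto simp: starts_at_def)
    moreover have "0 < n" using n assms(2) by (auto intro: gr0I)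
    ultimately have "n \<in> Gam m A"
      unfolding Gam_iff using less.prems smult_in_A[OF assms(1)] by blast
    then show False using n assms(3) by blast
  qed
qed

lemma ex_reduction:
  assumes "n \<le> m"
  shows "\<exists>a\<in>A. (\<forall>k<n. coeff a k = 0) \<and> (\<forall>\<gamma>\<in>Gam m A. n \<le> \<gamma> \<longrightarrow> coeff (p - a) \<gamma> = 0)"
  using assms
proof (induction n arbitrary: p rule: inc_induct)
  case base
  show ?case using zero_in_A by (intro bexI[of _ 0]) (auto simp: Gam_iff)
next
  case (step n)
  show ?case
  proof (cases "n \<in> Gam m A")
    case True
    then obtain g where g: "g \<in> A" "starts_at n g" by (auto simp: Gam_iff)
    define p' where "p' = p - smult (coeff p n) g"
    obtain a where a: "a \<in> A" "\<forall>k<Suc n. coeff a k = 0"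
      "\<forall>\<gamma>\<in>Gam m A. Suc n \<le> \<gamma> \<longrightarrow> coeff (p' - a) \<gamma> = 0"
      using step.IH[of p'] by blast
    have "coeff (p - (smult (coeff p n) g + a)) \<gamma> = 0" if "\<gamma> \<in> Gam m A" "n \<le> \<gamma>" for \<gamma>
    proof (cases "\<gamma> = n")
      case True
      then show ?thesis using g a by (simp add: starts_at_def)
    next
      case False
      then have "coeff (p' - a) \<gamma> = 0" using a(3) that by simp
      then show ?thesis by (simp add: p'_def diff_diff_eq)
    qed
    moreover have "smult (coeff p n) g + a \<in> A" using g a by (intro add_in_A smult_in_A)
    moreover have "\<forall>k<n. coeff (smult (coeff p n) g + a) k = 0"
      using g a by (simp add: starts_at_def)
    ultimately show ?thesis by blast
  next
    case False
    obtain a where a: "a \<in> A" "\<forall>k<Suc n. coeff a k = 0"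
      "\<forall>\<gamma>\<in>Gam m A. Suc n \<le> \<gamma> \<longrightarrow> coeff (p - a) \<gamma> = 0"
      using step.IH[of p] by blast
    then show ?thesis
      using False by (intro bexI[of _ a]) (auto simp: Suc_le_eq le_less)
  qed
qed

lemma ex_reduced_starts_at:
  assumes "\<gamma> \<in> Gam m A"
  shows "\<exists>f\<in>A. starts_at \<gamma> f \<and> (\<forall>k\<ge>m. coeff f k = 0) \<and>
    (\<forall>\<delta>\<in>Gam m A. \<delta> \<noteq> \<gamma> \<longrightarrow> coeff f \<delta> = 0)"
proof -
  obtain g where g: "g \<in> A" "starts_at \<gamma> g" and \<gamma>: "\<gamma> < m"
    using assms by (auto simp: Gam_iff)
  obtain a where a: "a \<in> A" "\<forall>k<Suc \<gamma>. coeff a k = 0"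
    "\<forall>\<delta>\<in>Gam m A. Suc \<gamma> \<le> \<delta> \<longrightarrow> coeff (g - a) \<delta> = 0"
    using ex_reduction[of "Suc \<gamma>" g] \<gamma> by auto
  let ?f = "poly_cutoff m (g - a)"
  have "?f \<in> A" by (intro poly_cutoff_in_A diff_in_A g a)
  moreover have "starts_at \<gamma> ?f"
    using g a \<gamma> by (auto simp: starts_at_def coeff_poly_cutoff)
  moreover have "coeff ?f \<delta> = 0" if "\<delta> \<in> Gam m A" "\<delta> \<noteq> \<gamma>" for \<delta>
    using that a(3) \<open>starts_at \<gamma> ?f\<close>
    by (cases "\<delta> < \<gamma>") (auto simp: starts_at_def coeff_poly_cutoff)
  ultimately show ?thesis by (auto simp: coeff_poly_cutoff)
qed

lemma canonical_form_iff:
  fixes f :: "'k poly"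
  assumes "\<gamma> \<in> Gam m A"
  shows "(\<exists>l. f = monom 1 \<gamma> + (\<Sum>\<delta>\<in>CGam m (Gam m A) \<gamma>. monom (l \<delta>) \<delta>)) \<longleftrightarrow>
    starts_at \<gamma> f \<and> (\<forall>k\<ge>m. coeff f k = 0) \<and> (\<forall>\<delta>\<in>Gam m A. \<delta> \<noteq> \<gamma> \<longrightarrow> coeff f \<delta> = 0)"
    (is "?L \<longleftrightarrow> ?R")
proof -
  have fin: "finite (CGam m (Gam m A) \<gamma>)" by (auto simp: CGam_def)
  have \<gamma>: "\<gamma> < m" using assms by (simp add: Gam_iff)
  have coeff: "coeff (monom 1 \<gamma> + (\<Sum>\<delta>\<in>CGam m (Gam m A) \<gamma>. monom (l \<delta>) \<delta>)) k =
      (if k = \<gamma> then 1 else if k \<in> CGam m (Gam m A) \<gamma> then l k else 0)" for l :: "nat \<Rightarrow> 'k" and k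
    using fin by (auto simp: coeff_sum sum.delta CGam_def)
  show ?thesis
  proof
    assume ?L
    then obtain l where f: "f = monom 1 \<gamma> + (\<Sum>\<delta>\<in>CGam m (Gam m A) \<gamma>. monom (l \<delta>) \<delta>)" ..
    have "coeff f k = (if k = \<gamma> then 1 else if k \<in> CGam m (Gam m A) \<gamma> then l k else 0)" for k
      unfolding f by (rule coeff)
    then show ?R
      using \<gamma> by (auto simp: starts_at_def CGam_def)
  next
    assume R: ?R
    have "f = monom 1 \<gamma> + (\<Sum>\<delta>\<in>CGam m (Gam m A) \<gamma>. monom (coeff f \<delta>) \<delta>)"
    proof (rule poly_eqI)
      fix k
      consider "k < \<gamma>" | "k = \<gamma>" | "k \<ge> m" | "k \<in> Gam m A" "k \<noteq> \<gamma>" | "k \<in> CGam m (Gam m A) \<gamma>"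
        by (cases "k < \<gamma>"; cases "k = \<gamma>"; cases "k \<ge> m"; cases "k \<in> Gam m A") (auto simp: CGam_def)
      then show "coeff f k = coeff (monom 1 \<gamma> + (\<Sum>\<delta>\<in>CGam m (Gam m A) \<gamma>. monom (coeff f \<delta>) \<delta>)) k"
        unfolding coeff using R by cases (auto simp: starts_at_def CGam_def)
    qed
    then show ?L by blast
  qed
qed

lemma is_canonical_basisD:
  assumes "is_canonical_basis m A h" "\<gamma> \<in> Gam m A"
  shows "h \<gamma> \<in> A" "starts_at \<gamma> (h \<gamma>)" "\<forall>k\<ge>m. coeff (h \<gamma>) k = 0"
    "\<forall>\<delta>\<in>Gam m A. \<delta> \<noteq> \<gamma> \<longrightarrow> coeff (h \<gamma>) \<delta> = 0"
proof -
  have "h \<gamma> \<in> polys.span (insert 1 (h ` Gam m A))"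
    using assms(2) by (intro polys.span_base) simp
  also have "\<dots> = poly_cutoff m ` A"
    using assms(1) by (simp add: is_canonical_basis_def)
  finally show "h \<gamma> \<in> A" using poly_cutoff_in_A by auto
  have "\<exists>l. h \<gamma> = monom 1 \<gamma> + (\<Sum>\<delta>\<in>CGam m (Gam m A) \<gamma>. monom (l \<delta>) \<delta>)"
    using assms unfolding is_canonical_basis_def by blast
  then show "starts_at \<gamma> (h \<gamma>)" "\<forall>k\<ge>m. coeff (h \<gamma>) k = 0"
    "\<forall>\<delta>\<in>Gam m A. \<delta> \<noteq> \<gamma> \<longrightarrow> coeff (h \<gamma>) \<delta> = 0"
    unfolding canonical_form_iff[OF assms(2)] by blast+
qed

lemma ex1_canonical_basis: "\<exists>!f. is_canonical_basis m A f"
proof (rule ex_ex1I)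
  obtain f where f: "\<And>\<gamma>. \<gamma> \<in> Gam m A \<Longrightarrow> f \<gamma> \<in> A \<and> starts_at \<gamma> (f \<gamma>) \<and>
      (\<forall>k\<ge>m. coeff (f \<gamma>) k = 0) \<and> (\<forall>\<delta>\<in>Gam m A. \<delta> \<noteq> \<gamma> \<longrightarrow> coeff (f \<gamma>) \<delta> = 0)"
    using ex_reduced_starts_at by metis
  define g where "g \<gamma> = (if \<gamma> \<in> Gam m A then f \<gamma> else 0)" for \<gamma>
  define B where "B = insert 1 (g ` Gam m A)"
  have g: "g \<gamma> \<in> A" "starts_at \<gamma> (g \<gamma>)" "\<And>k. k \<ge> m \<Longrightarrow> coeff (g \<gamma>) k = 0"
    "\<And>\<delta>. \<delta> \<in> Gam m A \<Longrightarrow> \<delta> \<noteq> \<gamma> \<Longrightarrow> coeff (g \<gamma>) \<delta> = 0" if "\<gamma> \<in> Gam m A" for \<gamma>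
    using f that by (auto simp: g_def)
  have "\<not> module.dependent smult B"
  proof (rule independent_starts_at)
    define d :: "'k poly \<Rightarrow> nat" where "d p = (LEAST n. coeff p n \<noteq> 0)" for p
    have d: "d p = n" if "starts_at n p" for n p
      unfolding d_def by (rule Least_equality) (use that not_le in \<open>auto simp: starts_at_def\<close>)
    show "starts_at (d p) p" if p: "p \<in> B" for p
    proof -
      have "\<exists>n. starts_at n p"
        using p g(2) starts_at_1 unfolding B_def by blast
      then obtain n where "starts_at n p" ..
      then show ?thesis using d by metis
    qed
    have "d 1 = 0" by (rule d) simp
    moreover have "d (g \<gamma>) = \<gamma>" if "\<gamma> \<in> Gam m A" for \<gamma>
      by (rule d) (rule g(2)[OF that])
    ultimately show "inj_on d B"
      unfolding B_def by (auto simp: inj_on_def Gam_iff)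
  qed
  moreover have "module.span smult B = poly_cutoff m ` A"
  proof (rule polys.span_subspace)
    show "B \<subseteq> poly_cutoff m ` A"
    proof
      fix p assume "p \<in> B"
      then have "p \<in> A"
        using g one_in_A by (auto simp: B_def)
      moreover have "poly_cutoff m p = p"
        using \<open>p \<in> B\<close> g m_pos by (auto simp: B_def poly_eq_iff coeff_poly_cutoff not_less)
      ultimately show "p \<in> poly_cutoff m ` A" by (metis imageI)
    qed
    have cutoff: "p \<in> poly_cutoff m ` A \<longleftrightarrow> p \<in> A \<and> (\<forall>k\<ge>m. coeff p k = 0)" for p
    proof
      assume "p \<in> A \<and> (\<forall>k\<ge>m. coeff p k = 0)"
      moreover from this have "poly_cutoff m p = p"
        by (auto simp: poly_eq_iff coeff_poly_cutoff)
      ultimately show "p \<in> poly_cutoff m ` A" by (metis imageI)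
    qed (auto simp: coeff_poly_cutoff poly_cutoff_in_A)
    then have "poly_cutoff m ` A = {p \<in> A. \<forall>k\<ge>m. coeff p k = 0}" by blast
    then show "polys.subspace (poly_cutoff m ` A)"
      by (auto simp: polys.subspace_def intro: add_in_A smult_in_A zero_in_A)
    show "poly_cutoff m ` A \<subseteq> polys.span B"
    proof
      fix p assume p: "p \<in> poly_cutoff m ` A"
      define q where "q = smult (coeff p 0) 1 + (\<Sum>\<gamma>\<in>Gam m A. smult (coeff p \<gamma>) (g \<gamma>))"
      have qA: "q \<in> A"
        unfolding q_def by (intro add_in_A smult_in_A sum_in_A one_in_A g)
      have zero: "0 \<notin> Gam m A" by (simp add: Gam_iff)
      have q0: "coeff q 0 = coeff p 0"
      proof -
        have "coeff (g \<gamma>) 0 = 0" if "\<gamma> \<in> Gam m A" for \<gamma>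
          using g(2)[OF that] that by (auto simp: starts_at_def Gam_iff)
        then show ?thesis by (simp add: q_def coeff_sum)
      qed
      have q\<gamma>: "coeff q \<gamma> = coeff p \<gamma>" if \<gamma>: "\<gamma> \<in> Gam m A" for \<gamma>
      proof -
        have "coeff p \<delta> * coeff (g \<delta>) \<gamma> = (if \<delta> = \<gamma> then coeff p \<gamma> else 0)"
          if "\<delta> \<in> Gam m A" for \<delta>
          using g(2,4)[OF that] \<gamma> by (auto simp: starts_at_def)
        moreover have "\<gamma> \<noteq> 0" using \<gamma> zero by metis
        ultimately show ?thesis
          using \<gamma> finite_Gam by (cases \<gamma>) (simp_all add: q_def coeff_sum sum.delta)
      qed
      have "p = q"
      proof (rule poly_eqI)
        fix k
        show "coeff p k = coeff q k"
        proof (cases "k < m")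
          case True
          have "coeff (p - q) k = 0"
            by (rule coeff_eq_0_outside_Gam) (use p True qA q0 q\<gamma> cutoff in \<open>auto intro: diff_in_A\<close>)
          then show ?thesis by simp
        next
          case False
          then show ?thesis
            using p g(3) m_pos by (cases k) (auto simp: cutoff q_def coeff_sum)
        qed
      qed
      moreover have "q \<in> polys.span B"
        unfolding q_def B_def
        by (intro polys.span_add polys.span_scale polys.span_sum) (auto intro: polys.span_base)
      ultimately show "p \<in> polys.span B" by (simp only:)
    qed
  qed
  moreover have "\<exists>l. g \<gamma> = monom 1 \<gamma> + (\<Sum>\<delta>\<in>CGam m (Gam m A) \<gamma>. monom (l \<delta>) \<delta>)"
    if "\<gamma> \<in> Gam m A" for \<gamma>
    unfolding canonical_form_iff[OF that] using g[OF that] by blast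
  moreover have "g \<gamma> = 0" if "\<gamma> \<notin> Gam m A" for \<gamma>
    using that by (simp add: g_def)
  ultimately have "is_canonical_basis m A g"
    unfolding is_canonical_basis_def B_def by blast
  then show "\<exists>f. is_canonical_basis m A f" by blast
next
  fix f g assume fg: "is_canonical_basis m A f" "is_canonical_basis m A g"
  note form = is_canonical_basisD[OF fg(1)] is_canonical_basisD[OF fg(2)]
  show "f = g"
  proof
    fix \<gamma>
    show "f \<gamma> = g \<gamma>"
    proof (cases "\<gamma> \<in> Gam m A")
      case False
      then show ?thesis using fg by (simp add: is_canonical_basis_def)
    next
      case True
      note forms = form[OF True]
      have \<gamma>: "0 < \<gamma>" using True by (simp add: Gam_iff)
      show ?thesis
      proof (rule poly_eqI)
        fix k
        show "coeff (f \<gamma>) k = coeff (g \<gamma>) k"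
        proof (cases "k < m")
          case True
          have "coeff (f \<gamma> - g \<gamma>) k = 0"
          proof (rule coeff_eq_0_outside_Gam[OF _ _ _ True])
            show "f \<gamma> - g \<gamma> \<in> A"
              using forms by (intro diff_in_A) auto
            show "coeff (f \<gamma> - g \<gamma>) 0 = 0"
              using forms \<gamma> by (simp add: starts_at_def)
            show "coeff (f \<gamma> - g \<gamma>) \<delta> = 0" if "\<delta> \<in> Gam m A" for \<delta>
              using forms that by (cases "\<delta> = \<gamma>") (simp_all add: starts_at_def)
          qed
          then show ?thesis by simp
        next
          case False
          then show ?thesis using forms by simp
        qed
      qed
    qed
  qed
qed

lemma canonical_basis_starts_at:
  assumes "\<gamma> \<in> Gam m A"
  shows "canonical_basis m A \<gamma> \<in> A" "starts_at \<gamma> (canonical_basis m A \<gamma>)"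
proof -
  have "is_canonical_basis m A (canonical_basis m A)"
    unfolding canonical_basis_def by (rule theI'[OF ex1_canonical_basis])
  then show "canonical_basis m A \<gamma> \<in> A" "starts_at \<gamma> (canonical_basis m A \<gamma>)"
    using is_canonical_basisD[OF _ assms] by blast+
qed

end

section \<open>Normal forms\<close>

lemma F_monom_in_mpolys_in: "F_monom \<Gamma> a \<in> mpolys_in (gens m \<Gamma>)"
  by (auto simp: F_monom_def gens_def intro!: prod_in_mpolys_in power_in_mpolys_in)

lemma F_monom_0 [simp]: "F_monom \<Gamma> 0 = 1"
  by (simp add: F_monom_def)

lemma F_monom_add: "F_monom \<Gamma> (a + b) = F_monom \<Gamma> a * F_monom \<Gamma> b"
  by (simp add: F_monom_def lookup_add power_add prod.distrib)

lemma F_monom_single: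
  assumes "j < card (ind \<Gamma>)"
  shows "F_monom \<Gamma> (Poly_Mapping.single j 1) = MVar (GenF j)"
proof -
  have "F_monom \<Gamma> (Poly_Mapping.single j 1) =
      (\<Prod>i<card (ind \<Gamma>). if i = j then MVar (GenF j) else 1)"
    unfolding F_monom_def by (rule prod.cong) (auto simp: lookup_single)
  then show ?thesis using assms by (simp add: prod.delta)
qed

context
  fixes A :: "'k::field poly set" and m :: nat
  assumes A: "A \<in> AA m" and SS: "Gam m A \<in> SS m"
begin

abbreviation (input) "rel_ideal \<equiv> mpoly_ideal (gens m (Gam m A)) (relations m A)"

lemma nu_in_Gam: "j < card (ind (Gam m A)) \<Longrightarrow> nu (Gam m A) j \<in> Gam m A"
  using nu_in_ind[OF SS_finite[OF SS]] ind_subset by blast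

lemma fpow_in_A: "fpow m A a \<in> A"
  unfolding fpow_def
  by (intro prod_in_A[OF A] power_in_A[OF A] canonical_basis_starts_at(1)[OF A] nu_in_Gam) simp

lemma fpow_starts_at: "starts_at (wt (Gam m A) a) (fpow m A a)"
  unfolding fpow_def wt_def
  by (intro starts_at_prod starts_at_power canonical_basis_starts_at(2)[OF A] nu_in_Gam) simp

lemma mpoly_eval_F_monom: "mpoly_eval (gen_val m A) (F_monom (Gam m A) a) = fpow m A a"
  by (simp add: F_monom_def fpow_def mpoly_eval_prod mpoly_eval_power)

lemma relations_in_mpolys_in: "relations m A \<subseteq> mpolys_in (gens m (Gam m A))"
proof -
  have "MVar (GenX i) \<in> mpolys_in (gens m (Gam m A))" if "i < m" for i
    using that by (auto simp: gens_def)
  moreover have "MVar (GenF j) \<in> mpolys_in (gens m (Gam m A))" if "j < card (ind (Gam m A))" for j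
    using that by (auto simp: gens_def)
  ultimately show ?thesis
    unfolding relations_def using m_pos[OF A]
    by (auto intro!: diff_in_mpolys_in mult_in_mpolys_in bracket_expr_in_mpolys_in F_monom_in_mpolys_in)
qed

(* The exponent m - 1 in the first family of relations is harmless because no weight equals m - 1. *)
lemma bracket_fpow:
  assumes "a \<in> Nideal (m - 1) (Gam m A)"
  shows "bracket m (fpow m A a) = fpow m A a"
proof (rule bracket_eq_self)
  fix k assume "k < m"
  have "m > 1"
    using A one_in_A[OF A] m_pos[OF A] by (cases "m = 1") (auto simp: AA_def)
  then have "m \<le> wt (Gam m A) a"
    using assms wt_less_iff[OF SS, of a] by (auto simp: Nideal_def)
  then show "coeff (fpow m A a) k = 0"
    using fpow_starts_at[of a] \<open>k < m\<close> by (auto simp: starts_at_def)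
qed

lemma mpoly_eval_relations: "r \<in> relations m A \<Longrightarrow> mpoly_eval (gen_val m A) r = 0"
  using m_pos[OF A] unfolding relations_def
  by (auto simp: mpoly_eval_diff mpoly_eval_mult mpoly_eval_bracket_expr mpoly_eval_F_monom
      bracket_fpow ind_Nideal_def bracket_monom_mult bracket_monom mult_monom ac_simps mult_2_right)

lemma mpoly_eval_rel_ideal: "P \<in> rel_ideal \<Longrightarrow> mpoly_eval (gen_val m A) P = 0"
  using mpoly_eval_ideal mpoly_eval_relations by blast

lemma GenX_mult_in_rel_ideal:
  assumes v: "v \<in> gens m (Gam m A)" and "r < m"
  shows "MVar v * MVar (GenX r) - bracket_expr m (monom 1 (m + r) * gen_val m A v) \<in> rel_ideal"
proof (cases v)
  case (GenF j)
  then have "MVar (GenX r) * MVar v - bracket_expr m (monom 1 (m + r) * gen_val m A v)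
      \<in> relations m A"
    using assms by (auto simp: relations_def gens_def)
  then show ?thesis by (simp add: generator_in_mpoly_ideal mult.commute)
next
  case (GenX i)
  then have "MVar v * MVar (GenX r) - bracket_expr m (monom 1 (2 * m + i + r)) \<in> relations m A"
    using assms by (auto simp: relations_def gens_def)
  moreover have "monom 1 (m + r) * gen_val m A v = monom 1 (2 * m + i + r)"
    by (simp add: GenX mult_monom ac_simps mult_2_right)
  ultimately show ?thesis by (simp add: generator_in_mpoly_ideal)
qed

lemma MVar_mult_bracket_expr:
  assumes v: "v \<in> gens m (Gam m A)"
  shows "MVar v * bracket_expr m p - bracket_expr m (gen_val m A v * bracket m p) \<in> rel_ideal"
proof (induction p rule: poly_monom_induct)
  case (monom c n)
  show ?case
  proof (cases "n < m")
    case True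
    then show ?thesis
      using m_pos[OF A] bracket_expr_cong[of m "monom c n" 0] by (simp add: bracket_monom)
  next
    case False
    define k r where "k = n div m - 1" and "r = n mod m"
    have "r < m" using m_pos[OF A] by (simp add: r_def)
    have "n div m = Suc k"
      using False m_pos[OF A] by (simp add: k_def div_greater_zero_iff)
    then have n: "n = m * k + (m + r)"
      using mult_div_mod_eq[of m n] by (simp add: r_def)
    let ?p = "monom 1 (m + r) * gen_val m A v"
    let ?q = "MConst c * MVar (GenX 0) ^ k"
    have "gen_val m A v * monom c n = smult c (monom 1 (m * k) * bracket m ?p)"
      by (simp add: n bracket_monom_mult mult_monom smult_monom mult.assoc[symmetric]
          flip: mult_smult_left)
    then have "bracket_expr m (gen_val m A v * monom c n) = ?q * bracket_expr m ?p"
      using m_pos[OF A] by (simp add: bracket_expr_smult bracket_expr_monom_mult mult.assoc)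
    moreover have "bracket_expr m (monom c n) = ?q * MVar (GenX r)"
      using False m_pos[OF A] by (simp add: bracket_expr_monom k_def r_def)
    ultimately have "MVar v * bracket_expr m (monom c n) - bracket_expr m (gen_val m A v * monom c n)
        = ?q * (MVar v * MVar (GenX r) - bracket_expr m ?p)"
      by (simp add: algebra_simps)
    moreover have "?q \<in> mpolys_in (gens m (Gam m A))"
      using m_pos[OF A] by (intro mult_in_mpolys_in power_in_mpolys_in) (auto simp: gens_def)
    ultimately show ?thesis
      using mult_in_mpoly_ideal[OF _ GenX_mult_in_rel_ideal[OF v \<open>r < m\<close>]] False
      by (simp add: bracket_monom)
  qed
next
  case (add p q)
  from add_in_mpoly_ideal[OF this] show ?case
    using m_pos[OF A] by (simp add: bracket_add bracket_expr_add algebra_simps)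
qed

lemma mult_bracket_expr:
  assumes "P \<in> mpolys_in (gens m (Gam m A))"
  shows "\<exists>q. P * bracket_expr m p - bracket_expr m q \<in> rel_ideal"
  using assms
proof (induction P rule: mpolys_in_induct)
  case (const c)
  then show ?case
    using m_pos[OF A] by (intro exI[of _ "smult c p"]) (simp add: bracket_expr_smult)
next
  case (add P Q)
  then obtain p1 p2 where "P * bracket_expr m p - bracket_expr m p1 \<in> rel_ideal"
    "Q * bracket_expr m p - bracket_expr m p2 \<in> rel_ideal" by blast
  from add_in_mpoly_ideal[OF this] show ?case
    using m_pos[OF A] by (intro exI[of _ "p1 + p2"]) (simp add: bracket_expr_add algebra_simps)
next
  case (mult_var v P)
  then obtain q where "P * bracket_expr m p - bracket_expr m q \<in> rel_ideal" by blast
  then have "MVar v * (P * bracket_expr m p - bracket_expr m q) \<in> rel_ideal"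
    using mult_var by (intro mult_in_mpoly_ideal) auto
  from add_in_mpoly_ideal[OF this MVar_mult_bracket_expr[OF mult_var(1), of q]]
  show ?case by (intro exI[of _ "gen_val m A v * bracket m q"]) (simp add: algebra_simps)
qed

context
  fixes rep :: "nat \<Rightarrow> nat \<Rightarrow>\<^sub>0 nat"
  assumes dec: "dec_ge2 (Gam m A) = {}"
    and rep: "\<And>\<gamma>. \<gamma> \<in> insert 0 (Gam m A) \<Longrightarrow>
      rep \<gamma> \<in> expvecs (card (ind (Gam m A))) \<and> wt (Gam m A) (rep \<gamma>) = \<gamma>"
begin

definition has_normal_form :: "(gen, 'k) mpoly \<Rightarrow> bool" where
  "has_normal_form P \<longleftrightarrow> (\<exists>u q. P - ((\<Sum>\<gamma>\<in>insert 0 (Gam m A).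
     MConst (u \<gamma>) * F_monom (Gam m A) (rep \<gamma>)) + bracket_expr m q) \<in> rel_ideal)"

lemma has_normal_form_cong:
  assumes "P - Q \<in> rel_ideal" "has_normal_form Q"
  shows "has_normal_form P"
proof -
  obtain u q where "Q - ((\<Sum>\<gamma>\<in>insert 0 (Gam m A).
     MConst (u \<gamma>) * F_monom (Gam m A) (rep \<gamma>)) + bracket_expr m q) \<in> rel_ideal"
    using assms(2) unfolding has_normal_form_def by blast
  from add_in_mpoly_ideal[OF assms(1) this] show ?thesis
    unfolding has_normal_form_def by (intro exI[of _ u] exI[of _ q]) (simp add: algebra_simps)
qed

lemma has_normal_form_add:
  assumes "has_normal_form P" "has_normal_form Q"
  shows "has_normal_form (P + Q)"
proof -
  obtain u q where 1: "P - ((\<Sum>\<gamma>\<in>insert 0 (Gam m A).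
     MConst (u \<gamma>) * F_monom (Gam m A) (rep \<gamma>)) + bracket_expr m q) \<in> rel_ideal"
    using assms(1) unfolding has_normal_form_def by blast
  obtain u' q' where 2: "Q - ((\<Sum>\<gamma>\<in>insert 0 (Gam m A).
     MConst (u' \<gamma>) * F_monom (Gam m A) (rep \<gamma>)) + bracket_expr m q') \<in> rel_ideal"
    using assms(2) unfolding has_normal_form_def by blast
  have "(P + Q) - ((\<Sum>\<gamma>\<in>insert 0 (Gam m A).
     MConst (u \<gamma> + u' \<gamma>) * F_monom (Gam m A) (rep \<gamma>)) + bracket_expr m (q + q')) \<in> rel_ideal"
    using add_in_mpoly_ideal[OF 1 2] m_pos[OF A]
    by (simp only: MConst_add distrib_right sum.distrib bracket_expr_add) (simp only: algebra_simps)
  then show ?thesis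
    unfolding has_normal_form_def by (intro exI[of _ "\<lambda>\<gamma>. u \<gamma> + u' \<gamma>"] exI[of _ "q + q'"])
qed

lemma has_normal_form_bracket_expr: "has_normal_form (bracket_expr m q)"
  unfolding has_normal_form_def by (intro exI[of _ "\<lambda>_. 0"] exI[of _ q]) simp

lemma has_normal_form_smult:
  assumes "has_normal_form P"
  shows "has_normal_form (MConst c * P)"
proof -
  obtain u q where *: "P - ((\<Sum>\<gamma>\<in>insert 0 (Gam m A).
     MConst (u \<gamma>) * F_monom (Gam m A) (rep \<gamma>)) + bracket_expr m q) \<in> rel_ideal"
    using assms unfolding has_normal_form_def by blast
  have "MConst c * P - ((\<Sum>\<gamma>\<in>insert 0 (Gam m A).
     MConst (c * u \<gamma>) * F_monom (Gam m A) (rep \<gamma>)) + bracket_expr m (smult c q)) \<in> rel_ideal"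
    using mult_in_mpoly_ideal[OF MConst_in_mpolys_in *, of c] m_pos[OF A]
    by (simp only: MConst_mult mult.assoc bracket_expr_smult distrib_left right_diff_distrib
        sum_distrib_left)
  then show ?thesis
    unfolding has_normal_form_def by (intro exI[of _ "\<lambda>\<gamma>. c * u \<gamma>"] exI[of _ "smult c q"])
qed

lemma has_normal_form_sum:
  "(\<And>i. i \<in> I \<Longrightarrow> has_normal_form (p i)) \<Longrightarrow> has_normal_form (sum p I)"
proof (induction I rule: infinite_finite_induct)
  case (insert i I)
  then show ?case by (auto intro: has_normal_form_add)
qed (use has_normal_form_bracket_expr[of 0] m_pos[OF A] in simp_all)

lemma has_normal_form_mult_bracket_expr:
  "P \<in> mpolys_in (gens m (Gam m A)) \<Longrightarrow> has_normal_form (P * bracket_expr m p)"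
  using mult_bracket_expr has_normal_form_cong has_normal_form_bracket_expr by blast

lemma has_normal_form_F_monom:
  assumes a: "a \<in> expvecs (card (ind (Gam m A)))"
  shows "has_normal_form (F_monom (Gam m A) a)"
proof (cases "wt (Gam m A) a < m")
  case True
  let ?\<gamma> = "wt (Gam m A) a"
  have mem: "?\<gamma> \<in> insert 0 (Gam m A)"
    using wt_in_SS[OF SS a _ True] by (cases "a = 0") auto
  then have "rep ?\<gamma> = a"
    using expvec_wt_unique[OF SS dec _ a] rep True by metis
  then have "(\<Sum>\<gamma>\<in>insert 0 (Gam m A).
        MConst (if \<gamma> = ?\<gamma> then 1 else 0 :: 'k) * F_monom (Gam m A) (rep \<gamma>))
      = (\<Sum>\<gamma>\<in>insert 0 (Gam m A). if \<gamma> = ?\<gamma> then F_monom (Gam m A) a else 0)"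
    by (intro sum.cong) auto
  also have "\<dots> = F_monom (Gam m A) a"
    using mem finite_Gam[OF A] by (subst sum.delta) auto
  finally show ?thesis
    unfolding has_normal_form_def using m_pos[OF A]
    by (intro exI[of _ "\<lambda>\<gamma>. if \<gamma> = ?\<gamma> then 1 else 0"] exI[of _ 0])
      (simp only: bracket_expr_0 add_0_right diff_self zero_in_mpoly_ideal)
next
  case False
  then have "a \<in> Nideal (m - 1) (Gam m A)" using a by (simp add: Nideal_def)
  then obtain c d where c: "c \<in> ind_Nideal (m - 1) (Gam m A)" and "a = c + d"
    using Nideal_split[OF SS] by blast
  have "F_monom (Gam m A) c - bracket_expr m (fpow m A c) \<in> rel_ideal"
    by (rule generator_in_mpoly_ideal) (use c in \<open>auto simp: relations_def\<close>)
  then have "F_monom (Gam m A) d * (F_monom (Gam m A) c - bracket_expr m (fpow m A c)) \<in> rel_ideal"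
    by (intro mult_in_mpoly_ideal F_monom_in_mpolys_in)
  then have "F_monom (Gam m A) a - F_monom (Gam m A) d * bracket_expr m (fpow m A c) \<in> rel_ideal"
    by (simp add: \<open>a = c + d\<close> F_monom_add algebra_simps)
  then show ?thesis
    using has_normal_form_cong has_normal_form_mult_bracket_expr F_monom_in_mpolys_in by blast
qed

lemma has_normal_form_MVar_mult_F_monom:
  assumes v: "v \<in> gens m (Gam m A)" and a: "a \<in> expvecs (card (ind (Gam m A)))"
  shows "has_normal_form (MVar v * F_monom (Gam m A) a)"
proof (cases v)
  case (GenF j)
  then have j: "j < card (ind (Gam m A))" using v by (auto simp: gens_def)
  have "has_normal_form (F_monom (Gam m A) (Poly_Mapping.single j 1 + a))"
    by (intro has_normal_form_F_monom add_in_expvecs single_in_expvecs j a)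
  then show ?thesis
    unfolding F_monom_add F_monom_single[OF j] GenF .
next
  case (GenX i)
  then have "i < m" using v by (auto simp: gens_def)
  then have "bracket_expr m (monom (1 :: 'k) (m + i)) = MVar v"
    using GenX m_pos[OF A] by (simp add: bracket_expr_monom)
  then show ?thesis
    using has_normal_form_mult_bracket_expr[OF F_monom_in_mpolys_in, of a "monom 1 (m + i)"]
    by (simp add: mult.commute)
qed

lemma has_normal_form:
  assumes "P \<in> mpolys_in (gens m (Gam m A))"
  shows "has_normal_form P"
  using assms
proof (induction P rule: mpolys_in_induct)
  case (const c)
  show ?case
    using has_normal_form_smult[OF has_normal_form_F_monom[OF zero_in_expvecs], of c] by simp
next
  case (add P Q)
  then show ?case by (intro has_normal_form_add)
next
  case (mult_var v P)
  then obtain u q where "P - ((\<Sum>\<gamma>\<in>insert 0 (Gam m A).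
     MConst (u \<gamma>) * F_monom (Gam m A) (rep \<gamma>)) + bracket_expr m q) \<in> rel_ideal"
    unfolding has_normal_form_def by blast
  then have "MVar v * (P - ((\<Sum>\<gamma>\<in>insert 0 (Gam m A).
     MConst (u \<gamma>) * F_monom (Gam m A) (rep \<gamma>)) + bracket_expr m q)) \<in> rel_ideal"
    using mult_var by (intro mult_in_mpoly_ideal) auto
  moreover have "MVar v * (P - ((\<Sum>\<gamma>\<in>insert 0 (Gam m A).
     MConst (u \<gamma>) * F_monom (Gam m A) (rep \<gamma>)) + bracket_expr m q)) =
     MVar v * P - ((\<Sum>\<gamma>\<in>insert 0 (Gam m A).
     MConst (u \<gamma>) * (MVar v * F_monom (Gam m A) (rep \<gamma>))) + MVar v * bracket_expr m q)"
    by (simp only: right_diff_distrib distrib_left sum_distrib_left mult.left_commute)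
  moreover have "has_normal_form ((\<Sum>\<gamma>\<in>insert 0 (Gam m A).
     MConst (u \<gamma>) * (MVar v * F_monom (Gam m A) (rep \<gamma>))) + MVar v * bracket_expr m q)"
    using rep mult_var(1)
    by (intro has_normal_form_add has_normal_form_sum has_normal_form_smult
        has_normal_form_MVar_mult_F_monom has_normal_form_mult_bracket_expr) auto
  ultimately show ?case using has_normal_form_cong by simp
qed

lemma kernel_subset_rel_ideal:
  assumes "P \<in> mpolys_in (gens m (Gam m A))" "mpoly_eval (gen_val m A) P = 0"
  shows "P \<in> rel_ideal"
proof -
  let ?S = "insert 0 (Gam m A)"
  obtain u q where *: "P - ((\<Sum>\<gamma>\<in>?S. MConst (u \<gamma>) * F_monom (Gam m A) (rep \<gamma>)) + bracket_expr m q) \<in> rel_ideal"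
    using has_normal_form[OF assms(1)] unfolding has_normal_form_def by blast
  have eq: "(\<Sum>\<gamma>\<in>?S. smult (u \<gamma>) (fpow m A (rep \<gamma>))) + bracket m q = 0"
    using mpoly_eval_rel_ideal[OF *]
    by (simp only: mpoly_eval_diff mpoly_eval_add mpoly_eval_sum mpoly_eval_MConst_mult
        mpoly_eval_F_monom mpoly_eval_bracket_expr[OF m_pos[OF A]] assms(2) diff_0
        neg_equal_0_iff_equal)
  have u: "u \<gamma> = 0" if "\<gamma> \<in> ?S" for \<gamma>
  proof (rule coeffs_eq_0_if_starts_at[of ?S "\<lambda>\<gamma>. \<gamma>" "\<lambda>\<gamma>. fpow m A (rep \<gamma>)" u])
    show "starts_at \<gamma> (fpow m A (rep \<gamma>))" if "\<gamma> \<in> ?S" for \<gamma>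
      using fpow_starts_at[of "rep \<gamma>"] rep[OF that] by simp
    show "coeff (\<Sum>\<gamma>\<in>?S. smult (u \<gamma>) (fpow m A (rep \<gamma>))) \<gamma> = 0" if "\<gamma> \<in> ?S" for \<gamma>
    proof -
      have "\<gamma> < m" using that m_pos[OF A] by (auto simp: Gam_iff[OF A])
      then show ?thesis
        using arg_cong[OF eq, of "\<lambda>p. coeff p \<gamma>"] by (simp only: coeff_add coeff_bracket) simp
    qed
  qed (use that finite_Gam[OF A] in auto)
  then have zero: "(\<Sum>\<gamma>\<in>?S. smult (u \<gamma>) (fpow m A (rep \<gamma>))) = 0"
    "(\<Sum>\<gamma>\<in>?S. MConst (u \<gamma>) * F_monom (Gam m A) (rep \<gamma>)) = (0 :: (gen, 'k) mpoly)"
    by (intro sum.neutral; simp)+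
  have "bracket_expr m q = bracket_expr m 0"
    using eq unfolding zero by (intro bracket_expr_cong m_pos[OF A]) simp
  then show ?thesis
    using * m_pos[OF A] unfolding zero by simp
qed

lemma A_subset_range:
  assumes "p \<in> A"
  shows "p \<in> mpoly_eval (gen_val m A) ` mpolys_in (gens m (Gam m A))"
proof -
  let ?E = "mpoly_eval (gen_val m A) ` mpolys_in (gens m (Gam m A))"
  have "p \<in> ?E" if "n \<le> m" "p \<in> A" "\<forall>k<n. coeff p k = 0" for n p
    using that
  proof (induction n arbitrary: p rule: inc_induct)
    case base
    then have "mpoly_eval (gen_val m A) (bracket_expr m p) = p"
      using m_pos[OF A] by (simp add: mpoly_eval_bracket_expr bracket_eq_self)
    then show ?case using bracket_expr_in_mpolys_in[OF m_pos[OF A]] by (metis imageI)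
  next
    case (step n)
    show ?case
    proof (cases "coeff p n = 0")
      case True
      then show ?thesis using step.IH[of p] step.prems by (auto simp: less_Suc_eq)
    next
      case False
      then have "starts_at n (smult (inverse (coeff p n)) p)"
        using step.prems by (simp add: starts_at_def)
      moreover have "smult (inverse (coeff p n)) p \<in> A"
        by (rule smult_in_A[OF A step.prems(1)])
      ultimately have "n \<in> insert 0 (Gam m A)"
        using step.hyps by (auto simp: Gam_iff[OF A])
      then have st: "starts_at n (fpow m A (rep n))"
        using rep fpow_starts_at[of "rep n"] by metis
      define p' where "p' = p - smult (coeff p n) (fpow m A (rep n))"
      have "p' \<in> A"
        unfolding p'_def by (intro diff_in_A[OF A] smult_in_A[OF A] fpow_in_A step.prems)
      moreover have "\<forall>k<Suc n. coeff p' k = 0"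
        using st step.prems(2) by (auto simp: p'_def starts_at_def less_Suc_eq)
      ultimately obtain P where P: "P \<in> mpolys_in (gens m (Gam m A))"
        "mpoly_eval (gen_val m A) P = p'"
        using step.IH[of p'] by blast
      let ?Q = "P + MConst (coeff p n) * F_monom (Gam m A) (rep n)"
      have "mpoly_eval (gen_val m A) ?Q = p"
        using P by (simp add: mpoly_eval_add mpoly_eval_mult mpoly_eval_F_monom p'_def)
      moreover have "?Q \<in> mpolys_in (gens m (Gam m A))"
        by (intro add_in_mpolys_in mult_in_mpolys_in P F_monom_in_mpolys_in MConst_in_mpolys_in)
      ultimately show ?thesis by (metis imageI)
    qed
  qed
  from this[of 0 p] assms show ?thesis by simp
qed

end

lemma range_subset_A:
  assumes "P \<in> mpolys_in (gens m (Gam m A))"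
  shows "mpoly_eval (gen_val m A) P \<in> A"
  using assms
proof (induction P rule: mpolys_in_induct)
  case (const c)
  show ?case using smult_in_A[OF A one_in_A[OF A], of c] by simp
next
  case (add P Q)
  then show ?case by (simp add: mpoly_eval_add add_in_A[OF A])
next
  case (mult_var v P)
  have "gen_val m A v \<in> A"
  proof (cases v)
    case (GenF j)
    then show ?thesis
      using mult_var(1) canonical_basis_starts_at(1)[OF A nu_in_Gam] by (auto simp: gens_def)
  next
    case (GenX i)
    then show ?thesis using conductor_in_A[OF A] by simp
  qed
  then show ?case using mult_var by (simp add: mpoly_eval_mult mult_in_A[OF A])
qed

end

theorem corollary2p16:
  fixes A :: "'k::field poly set" and m :: nat and \<Gamma> :: "nat set"
  assumes "m \<ge> 4"
    and "\<Gamma> \<in> SS m"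
    and "A \<in> AAG m \<Gamma>"
    and "card (ind \<Gamma>) \<ge> 2"
    and "dec_ge2 \<Gamma> = {}"
  shows "presented_by A (gens m \<Gamma>) (gen_val m A) (relations m A)"
proof -
  have A: "A \<in> AA m" and \<Gamma>: "\<Gamma> = Gam m A"
    using assms(3) by (auto simp: AAG_def)
  have SS: "Gam m A \<in> SS m" and dec: "dec_ge2 (Gam m A) = {}"
    using assms \<Gamma> by auto
  have "\<exists>a. a \<in> expvecs (card (ind (Gam m A))) \<and> wt (Gam m A) a = \<gamma>"
    if "\<gamma> \<in> insert 0 (Gam m A)" for \<gamma>
  proof (cases "\<gamma> = 0")
    case True
    then show ?thesis by (intro exI[of _ 0]) simp
  next
    case False
    then show ?thesis
      using ex_expvec_wt[OF finite_Gam[OF A]] that by (force simp: Gam_iff[OF A])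
  qed
  then obtain rep where rep: "\<And>\<gamma>. \<gamma> \<in> insert 0 (Gam m A) \<Longrightarrow>
      rep \<gamma> \<in> expvecs (card (ind (Gam m A))) \<and> wt (Gam m A) (rep \<gamma>) = \<gamma>"
    by metis
  show ?thesis
    unfolding presented_by_def \<Gamma>
    using relations_in_mpolys_in[OF A SS] range_subset_A[OF A SS] A_subset_range[OF A SS dec rep]
      kernel_subset_rel_ideal[OF A SS dec rep] mpoly_eval_rel_ideal[OF A SS]
      mpoly_ideal_subset[OF relations_in_mpolys_in[OF A SS]]
    by blast
qed

end
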